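(* Let $m>1$, let $a_1,\ldots,a_m$ be integers bigger than one, and let $$G=G_{a_1,\ldots,a_m}=\langle x_1,\ldots,x_m \mid x_1^{a_1}=x_2^{a_2}=\cdots=x_m^{a_m}\rangle.$$ Then the natural right $G$-action on $\mathrm{LO}(G)$ has at least $2(m-1)!$ distinct orbits consisting of isolated orderings.
   Context: A left ordering of a group $G$ is a total ordering $<$ on $G$ such that $g<g'$ implies $hg<hg'$ for all $g,g',h\in G$. $\mathrm{LO}(G)$ is the set of left orderings of $G$ with the topology having open sub-basis $U_g=\{<\ : 1<g\}$, $g\in G$. An isolated ordering is an isolated point of $\mathrm{LO}(G)$. The natural right $G$-action on $\mathrm{LO}(G)$ sends a left ordering $<$ and $g\in G$ to the left ordering $<\cdot g$ defined by $h\,(<\cdot g)\,h'$ if $hg<h'g$; this action is continuous and sends isolated orderings to isolated orderings. *)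

theory Defs
  imports "HOL-Algebra.Group_Action" "HOL-Analysis.Abstract_Topology"
begin

section \<open>Groups given by generators and relations\<close>

text \<open>
  A letter \<open>(x, True)\<close> stands for the generator \<open>x\<close>, and \<open>(x, False)\<close> for its formal inverse.
\<close>

definition words :: "'a set \<Rightarrow> ('a \<times> bool) list set"
  where "words S = lists (S \<times> UNIV)"

inductive_set word_eq :: "'a set \<Rightarrow> (('a \<times> bool) list \<times> ('a \<times> bool) list) set"
  for S :: "'a set"
  where
    refl: "w \<in> words S \<Longrightarrow> (w, w) \<in> word_eq S"
  | cancel: "\<lbrakk>u \<in> words S; v \<in> words S; x \<in> S\<rbrakk> \<Longrightarrow> (u @ (x, b) # (x, \<not> b) # v, u @ v) \<in> word_eq S"
  | sym: "(v, w) \<in> word_eq S \<Longrightarrow> (w, v) \<in> word_eq S"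
  | trans: "\<lbrakk>(u, v) \<in> word_eq S; (v, w) \<in> word_eq S\<rbrakk> \<Longrightarrow> (u, w) \<in> word_eq S"

definition free_group :: "'a set \<Rightarrow> ('a \<times> bool) list set monoid"
  where "free_group S =
    \<lparr>carrier = words S // word_eq S,
     mult = \<lambda>A B. (\<Union>u\<in>A. \<Union>v\<in>B. word_eq S `` {u @ v}),
     one = word_eq S `` {[]}\<rparr>"

definition free_gen :: "'a set \<Rightarrow> 'a \<Rightarrow> ('a \<times> bool) list set"
  where "free_gen S x = word_eq S `` {[(x, True)]}"

definition normal_closure :: "('a, 'b) monoid_scheme \<Rightarrow> 'a set \<Rightarrow> 'a set"
  where "normal_closure G R = \<Inter>{N. N \<lhd> G \<and> R \<subseteq> N}"

definition presented_group :: "'a set \<Rightarrow> ('a \<times> bool) list set set \<Rightarrow> ('a \<times> bool) list set set monoid"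
  where "presented_group S R = free_group S Mod normal_closure (free_group S) R"

text \<open>
  The chain \<open>x\<^sub>1\<^bsup>a\<^sub>1\<^esup> = \<dots> = x\<^sub>m\<^bsup>a\<^sub>m\<^esup>\<close> is read as the \<open>m - 1\<close> relations between neighbours;
  the values of \<open>a\<close> outside \<open>{1..m}\<close> play no role.
\<close>

definition equal_powers_group :: "nat \<Rightarrow> (nat \<Rightarrow> nat) \<Rightarrow> (nat \<times> bool) list set set monoid"
  where "equal_powers_group m a =
    (let F = free_group {1..m}; x = free_gen {1..m} in
     presented_group {1..m}
       {(x i [^]\<^bsub>F\<^esub> a i) \<otimes>\<^bsub>F\<^esub> inv\<^bsub>F\<^esub> (x (Suc i) [^]\<^bsub>F\<^esub> a (Suc i)) |i. i \<in> {1..<m}})"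


section \<open>The space of left orderings\<close>

definition left_orderings :: "('a, 'b) monoid_scheme \<Rightarrow> 'a rel set"
  where "left_orderings G =
    {r. r \<subseteq> carrier G \<times> carrier G \<and> strict_linear_order_on (carrier G) r \<and>
        (\<forall>g\<in>carrier G. \<forall>g'\<in>carrier G. \<forall>h\<in>carrier G.
           (g, g') \<in> r \<longrightarrow> (h \<otimes>\<^bsub>G\<^esub> g, h \<otimes>\<^bsub>G\<^esub> g') \<in> r)}"

text \<open>
  The whole space is added to the sub-basis because \<^const>\<open>topology_generated_by\<close> forms no empty
  intersections; this matters only for the trivial group.
\<close>

definition LO :: "('a, 'b) monoid_scheme \<Rightarrow> 'a rel topology"
  where "LO G = topology_generated_by
    (insert (left_orderings G) {{r \<in> left_orderings G. (\<one>\<^bsub>G\<^esub>, g) \<in> r} |g. g \<in> carrier G})"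

definition isolated_orderings :: "('a, 'b) monoid_scheme \<Rightarrow> 'a rel set"
  where "isolated_orderings G = {r \<in> topspace (LO G). openin (LO G) {r}}"

text \<open>
  \<open>LO_translate G g r\<close> is the ordering \<open>r \<cdot> g\<close> with \<open>h (r \<cdot> g) h'\<close> iff \<open>(h g) r (h' g)\<close>. With this
  formula \<open>g \<mapsto> (r \<mapsto> r \<cdot> g)\<close> is a homomorphism into the bijections of the space of left orderings;
  composing with inversion turns it into a right action with the same orbits.
\<close>

definition LO_translate :: "('a, 'b) monoid_scheme \<Rightarrow> 'a \<Rightarrow> 'a rel \<Rightarrow> 'a rel"
  where "LO_translate G g =
    (\<lambda>r\<in>left_orderings G.
       {(h, h') \<in> carrier G \<times> carrier G. (h \<otimes>\<^bsub>G\<^esub> g, h' \<otimes>\<^bsub>G\<^esub> g) \<in> r})"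


section \<open>Well-definedness\<close>

lemma words_simps [simp]:
  "[] \<in> words S"
  "p # w \<in> words S \<longleftrightarrow> fst p \<in> S \<and> w \<in> words S"
  "u @ v \<in> words S \<longleftrightarrow> u \<in> words S \<and> v \<in> words S"
  by (auto simp: words_def mem_Times_iff)

lemma word_eq_words: "(u, v) \<in> word_eq S \<Longrightarrow> u \<in> words S \<and> v \<in> words S"
  by (induction rule: word_eq.induct) auto

lemma equiv_word_eq: "equiv (words S) (word_eq S)"
proof (rule equivI)
  show "word_eq S \<subseteq> words S \<times> words S"
    using word_eq_words by auto
  show "refl_on (words S) (word_eq S)"
    by (auto simp: refl_on_def intro: word_eq.refl)
  show "sym (word_eq S)"
    by (auto simp: sym_def intro: word_eq.sym)
  show "trans (word_eq S)"
    by (meson transI word_eq.trans)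
qed

lemma word_eq_append:
  assumes "(u, u') \<in> word_eq S" "(v, v') \<in> word_eq S"
  shows "(u @ v, u' @ v') \<in> word_eq S"
proof -
  have left: "(u @ w, u' @ w) \<in> word_eq S" if "w \<in> words S" for w
    using assms(1)
  proof (induction rule: word_eq.induct)
    case (cancel u v x b)
    then show ?case
      using word_eq.cancel[of u S "v @ w" x b] that by simp
  qed (use that in \<open>auto intro: word_eq.refl word_eq.sym word_eq.trans\<close>)
  have right: "(w @ v, w @ v') \<in> word_eq S" if "w \<in> words S" for w
    using assms(2)
  proof (induction rule: word_eq.induct)
    case (cancel u v x b)
    then show ?case
      using word_eq.cancel[of "w @ u" S v x b] that by simp
  qed (use that in \<open>auto intro: word_eq.refl word_eq.sym word_eq.trans\<close>)
  show ?thesis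
    using left right assms word_eq.trans word_eq_words by blast
qed

lemma free_group_mult:
  assumes "u \<in> words S" "v \<in> words S"
  shows "word_eq S `` {u} \<otimes>\<^bsub>free_group S\<^esub> word_eq S `` {v} = word_eq S `` {u @ v}"
proof -
  have "word_eq S `` {u' @ v'} = word_eq S `` {u @ v}"
    if "u' \<in> word_eq S `` {u}" "v' \<in> word_eq S `` {v}" for u' v'
  proof -
    have "(u @ v, u' @ v') \<in> word_eq S"
      using that by (intro word_eq_append) auto
    then show ?thesis
      by (rule equiv_class_eq[OF equiv_word_eq, symmetric])
  qed
  moreover have "u \<in> word_eq S `` {u}" "v \<in> word_eq S `` {v}"
    using assms by (auto intro: word_eq.refl)
  ultimately have "(\<Union>u'\<in>word_eq S `` {u}. \<Union>v'\<in>word_eq S `` {v}. word_eq S `` {u' @ v'}) =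
      word_eq S `` {u @ v}"
    by blast
  then show ?thesis
    by (simp add: free_group_def)
qed

lemma word_eq_inverse:
  "w \<in> words S \<Longrightarrow> (rev (map (apsnd Not) w) @ w, []) \<in> word_eq S"
proof (induction w)
  case (Cons p w)
  obtain x b where p: "p = (x, b)" by fastforce
  have inv: "rev (map (apsnd Not) w) \<in> words S"
    using word_eq_words[OF Cons.IH] Cons.prems by simp
  have "(rev (map (apsnd Not) w) @ (x, \<not> b) # (x, \<not> \<not> b) # w, rev (map (apsnd Not) w) @ w) \<in> word_eq S"
    using Cons.prems inv p by (intro word_eq.cancel) auto
  then show ?case
    using Cons p by (auto intro: word_eq.trans)
qed (auto intro: word_eq.refl)

lemma group_free_group: "group (free_group S)"
proof (rule groupI)
  let ?F = "free_group S"
  have car: "\<exists>u\<in>words S. A = word_eq S `` {u}" if "A \<in> carrier ?F" for A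
    using that by (auto simp: free_group_def quotient_def)
  have cl: "word_eq S `` {u} \<in> carrier ?F" if "u \<in> words S" for u
    using that by (auto simp: free_group_def intro: quotientI)
  have one: "\<one>\<^bsub>?F\<^esub> = word_eq S `` {[]}"
    by (simp add: free_group_def)
  show "A \<otimes>\<^bsub>?F\<^esub> B \<in> carrier ?F" if prems: "A \<in> carrier ?F" "B \<in> carrier ?F" for A B
  proof -
    obtain u v where "u \<in> words S" "v \<in> words S" "A = word_eq S `` {u}" "B = word_eq S `` {v}"
      using car prems by meson
    then show ?thesis
      using cl[of "u @ v"] by (simp add: free_group_mult)
  qed
  show "\<one>\<^bsub>?F\<^esub> \<in> carrier ?F"
    unfolding one by (rule cl) simp
  show "A \<otimes>\<^bsub>?F\<^esub> B \<otimes>\<^bsub>?F\<^esub> C = A \<otimes>\<^bsub>?F\<^esub> (B \<otimes>\<^bsub>?F\<^esub> C)"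
    if prems: "A \<in> carrier ?F" "B \<in> carrier ?F" "C \<in> carrier ?F" for A B C
  proof -
    obtain u v w where "u \<in> words S" "v \<in> words S" "w \<in> words S"
      "A = word_eq S `` {u}" "B = word_eq S `` {v}" "C = word_eq S `` {w}"
      using car prems by meson
    then show ?thesis
      by (simp add: free_group_mult)
  qed
  show "\<one>\<^bsub>?F\<^esub> \<otimes>\<^bsub>?F\<^esub> A = A" if prems: "A \<in> carrier ?F" for A
  proof -
    obtain u where "u \<in> words S" "A = word_eq S `` {u}"
      using car prems by meson
    then show ?thesis
      using free_group_mult[of "[]" S u] by (simp add: one)
  qed
  show "\<exists>B\<in>carrier ?F. B \<otimes>\<^bsub>?F\<^esub> A = \<one>\<^bsub>?F\<^esub>" if A: "A \<in> carrier ?F" for A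
  proof -
    obtain u where u: "u \<in> words S" "A = word_eq S `` {u}"
      using car[OF A] by blast
    have inv: "rev (map (apsnd Not) u) \<in> words S"
      using word_eq_words[OF word_eq_inverse[OF u(1)]] by simp
    have "word_eq S `` {rev (map (apsnd Not) u)} \<otimes>\<^bsub>?F\<^esub> A = \<one>\<^bsub>?F\<^esub>"
      using u inv one equiv_class_eq[OF equiv_word_eq word_eq_inverse[OF u(1)]]
      by (simp add: free_group_mult)
    then show ?thesis
      using cl[OF inv] by blast
  qed
qed

lemma free_gen_closed: "x \<in> S \<Longrightarrow> free_gen S x \<in> carrier (free_group S)"
  by (auto simp: free_group_def free_gen_def intro: quotientI)

lemma (in group) normal_normal_closure:
  assumes "R \<subseteq> carrier G"
  shows "normal_closure G R \<lhd> G"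
proof -
  have "carrier G \<lhd> G"
    by (auto simp: normal_inv_iff subgroup_self)
  then have "subgroup (normal_closure G R) G"
    unfolding normal_closure_def using assms
    by (intro subgroups_Inter) (auto simp: normal_imp_subgroup)
  then show ?thesis
    unfolding normal_inv_iff normal_closure_def
    by (auto simp: normal.inv_op_closed2)
qed

lemma group_presented_group:
  "R \<subseteq> carrier (free_group S) \<Longrightarrow> group (presented_group S R)"
  unfolding presented_group_def
  by (rule normal.factorgroup_is_group [OF group.normal_normal_closure [OF group_free_group]])

lemma group_equal_powers_group: "group (equal_powers_group m a)"
proof -
  interpret F: group "free_group {1..m}" by (rule group_free_group)
  have "free_gen {1..m} i [^]\<^bsub>free_group {1..m}\<^esub> a i \<in> carrier (free_group {1..m})"
    if "i \<in> {1..m}" for i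
    using that by (intro F.nat_pow_closed free_gen_closed)
  then show ?thesis
    unfolding equal_powers_group_def Let_def
    by (intro group_presented_group subsetI) (auto intro!: F.m_closed F.inv_closed simp del: One_nat_def)
qed

lemma topspace_LO: "topspace (LO G) = left_orderings G"
  by (auto simp: LO_def)

lemma (in group) group_action_LO_translate:
  "group_action G (left_orderings G) (LO_translate G)"
proof -
  let ?E = "left_orderings G" and ?\<phi> = "LO_translate G"
  have mem: "?\<phi> g r \<in> ?E" if g: "g \<in> carrier G" and r: "r \<in> ?E" for g r
  proof -
    have tr: "trans r" and ir: "irrefl r" and tot: "total_on (carrier G) r"
      and inv: "\<And>u v h. \<lbrakk>u \<in> carrier G; v \<in> carrier G; h \<in> carrier G; (u, v) \<in> r\<rbrakk> \<Longrightarrow> (h \<otimes> u, h \<otimes> v) \<in> r"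
      using r by (auto simp: left_orderings_def strict_linear_order_on_def)
    have "trans (?\<phi> g r)"
      using r tr by (auto simp: LO_translate_def trans_def)
    moreover have "irrefl (?\<phi> g r)"
      using r ir by (auto simp: LO_translate_def irrefl_def)
    moreover have "total_on (carrier G) (?\<phi> g r)"
      using r tot g by (auto simp: LO_translate_def total_on_def)
    moreover have "(h \<otimes> u, h \<otimes> v) \<in> ?\<phi> g r"
      if "u \<in> carrier G" "v \<in> carrier G" "h \<in> carrier G" "(u, v) \<in> ?\<phi> g r" for u v h
      using that r g inv[of "u \<otimes> g" "v \<otimes> g" h] by (auto simp: LO_translate_def m_assoc)
    ultimately show ?thesis
      using r by (auto simp: left_orderings_def strict_linear_order_on_def LO_translate_def)
  qed
  have comp: "?\<phi> g (?\<phi> h r) = ?\<phi> (g \<otimes> h) r"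
    if "g \<in> carrier G" "h \<in> carrier G" "r \<in> ?E" for g h r
    using that mem[of h r] by (auto simp: LO_translate_def m_assoc)
  have one: "?\<phi> \<one> r = r" if "r \<in> ?E" for r
    using that by (auto simp: LO_translate_def left_orderings_def)
  have bij: "?\<phi> g \<in> Bij ?E" if g: "g \<in> carrier G" for g
  proof -
    have "bij_betw (?\<phi> g) ?E ?E"
      using g mem comp one
      by (intro bij_betw_byWitness[where f' = "?\<phi> (inv g)"]) auto
    then show ?thesis
      by (simp add: Bij_def LO_translate_def)
  qed
  have "?\<phi> (g \<otimes> h) = ?\<phi> g \<otimes>\<^bsub>BijGroup ?E\<^esub> ?\<phi> h" if "g \<in> carrier G" "h \<in> carrier G" for g h
  proof -
    have "?\<phi> (g \<otimes> h) r = compose ?E (?\<phi> g) (?\<phi> h) r" for r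
      using comp[OF that, of r] by (cases "r \<in> ?E") (simp add: compose_def, simp add: compose_def LO_translate_def)
    then show ?thesis
      using that bij by (auto simp: BijGroup_def)
  qed
  then have "?\<phi> \<in> hom G (BijGroup ?E)"
    using bij by (auto simp: hom_def BijGroup_def)
  then show ?thesis
    unfolding group_action_def
    by (intro group_hom.intro group_hom_axioms.intro group_BijGroup is_group)
qed

end

theory Submission
  imports Defs "HOL-Algebra.Generated_Groups" "HOL-Combinatorics.Multiset_Permutations" Complex_Main
begin

text \<open>
  Let \<open>z\<close> be the common value of the powers \<open>x\<^sub>i\<^bsup>a\<^sub>i\<^esup>\<close>; it is central. For each ordering of the
  generators, say \<open>x\<^sub>0, \<dots>, x\<^bsub>m-1\<^esub>\<close>, the elements \<open>g\<^sub>i = z\<^bsup>1-(m-i)\<^esup> x\<^sub>i \<cdots> x\<^bsub>m-1\<^esub>\<close> generate a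
  monoid \<open>M\<close>. A ping-pong argument inside the preorder \<open>u \<preceq> v \<longleftrightarrow> u\<^bsup>-1\<^esup> v \<in> M\<close>, applied to
  alternating words in the \<open>x\<^sub>i\<close>, shows that \<open>M\<close> and its inverse cover the group. An action on the
  line in which \<open>z\<close> is the unit translation and every \<open>g\<^sub>i\<close> moves the point \<open>0\<close> to the right shows
  that no product of the \<open>g\<^sub>i\<close> is trivial. Hence \<open>M\<close> without \<open>1\<close> is a finitely generated positive
  cone, so its ordering and the opposite one are isolated.

  The sign of the central element \<open>z\<close> distinguishes the orbits of an ordering and of its opposite.
  For orderings of the generators with the same last one, the orbits differ by a translation number
  estimate: if \<open>\<pi>\<close> is a nontrivial permutation fixing \<open>m - 1\<close>, the powers of
  \<open>W = x\<^bsub>\<pi>(0)\<^esub> \<cdots> x\<^bsub>\<pi>(m-1)\<^esub>\<close> grow at most like those of \<open>z\<^bsup>c\<^esup>\<close>, where \<open>c \<le> m - 2\<close> is the number of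
  ascents of \<open>\<pi>\<close>, so no conjugate of \<open>z\<^bsup>1-m\<^esup> W\<close> is positive.
\<close>

section \<open>Presented groups\<close>

lemma (in group) eq_if_mult_inv_eq_one:
  assumes "u \<in> carrier G" "v \<in> carrier G" "u \<otimes> inv v = \<one>"
  shows "u = v"
  using assms inv_equality[of u "inv v"] by simp

text \<open>Words are evaluated letter by letter. A cancelling pair evaluates to the unit, so the
  value depends only on the \<open>word_eq\<close> class.\<close>

lemma (in group) free_group_hom:
  assumes f: "f \<in> S \<rightarrow> carrier G"
  obtains h where "h \<in> hom (free_group S) G" "\<And>x. x \<in> S \<Longrightarrow> h (free_gen S x) = f x"
proof -
  define val where
    "val = (\<lambda>w. foldr (\<lambda>p t. (if snd p then f (fst p) else inv f (fst p)) \<otimes> t) w \<one>)"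
  have val_closed: "val w \<in> carrier G" if "w \<in> words S" for w
    using that f by (induction w) (auto simp: val_def)
  have val_append: "val (u @ v) = val u \<otimes> val v" if "u \<in> words S" "v \<in> words S" for u v
    using that
  proof (induction u)
    case (Cons p u)
    then have "f (fst p) \<in> carrier G" using f by auto
    then show ?case using Cons val_closed[of u] val_closed[of v] by (simp add: val_def m_assoc)
  qed (use val_closed[OF that(2)] in \<open>simp add: val_def\<close>)
  have val_cong: "val u = val v" if "(u, v) \<in> word_eq S" for u v
    using that
  proof (induction rule: word_eq.induct)
    case (cancel u v x b)
    have fx: "f x \<in> carrier G" using cancel f by auto
    have "val ((x, b) # (x, \<not> b) # v) = val v"
      using val_closed[of v] cancel fx inv_solve_left
      by (cases b) (auto simp: val_def m_assoc[symmetric] simp del: m_assoc)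
    then show ?case using cancel by (simp add: val_append)
  qed auto
  \<comment> \<open>By \<open>val_cong\<close> every representative of a class gives the same value,
    so the choice is harmless.\<close>
  define h where "h A = val (SOME w. w \<in> A)" for A
  have h: "h (word_eq S `` {w}) = val w" if "w \<in> words S" for w
  proof -
    have "w \<in> word_eq S `` {w}" using that by (auto intro: word_eq.refl)
    then have "(w, SOME v. v \<in> word_eq S `` {w}) \<in> word_eq S"
      by (metis Image_singleton_iff someI)
    then show ?thesis using val_cong by (simp add: h_def)
  qed
  show thesis
  proof
    show "h \<in> hom (free_group S) G"
    proof (rule homI)
      show "h A \<in> carrier G" if "A \<in> carrier (free_group S)" for A
        using that h val_closed by (auto simp: free_group_def quotient_def)
      show "h (A \<otimes>\<^bsub>free_group S\<^esub> B) = h A \<otimes> h B"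
        if "A \<in> carrier (free_group S)" "B \<in> carrier (free_group S)" for A B
      proof -
        have "\<exists>u\<in>words S. C = word_eq S `` {u}" if "C \<in> carrier (free_group S)" for C
          using that by (auto simp: free_group_def quotient_def)
        with that obtain u v where "u \<in> words S" "A = word_eq S `` {u}" "v \<in> words S" "B = word_eq S `` {v}"
          by meson
        then show ?thesis by (simp add: free_group_mult h val_append)
      qed
    qed
    show "h (free_gen S x) = f x" if "x \<in> S" for x
      using that funcset_mem[OF f that] unfolding free_gen_def by (subst h) (auto simp: val_def)
  qed
qed

lemma generate_free_gen: "generate (free_group S) (free_gen S ` S) = carrier (free_group S)"
proof -
  interpret F: group "free_group S" by (rule group_free_group)
  have sub: "free_gen S ` S \<subseteq> carrier (free_group S)" using free_gen_closed by auto
  let ?K = "generate (free_group S) (free_gen S ` S)"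
  have one: "\<one>\<^bsub>free_group S\<^esub> = word_eq S `` {[]}" by (simp add: free_group_def)
  have neg: "word_eq S `` {[(x, False)]} = inv\<^bsub>free_group S\<^esub> (free_gen S x)" if "x \<in> S" for x
  proof -
    have "([(x, False), (x, True)], []) \<in> word_eq S"
      using word_eq.cancel[of "[]" S "[]" x False] that by simp
    then have "word_eq S `` {[(x, False), (x, True)]} = \<one>\<^bsub>free_group S\<^esub>"
      using equiv_class_eq[OF equiv_word_eq] one by metis
    then have "word_eq S `` {[(x, False)]} \<otimes>\<^bsub>free_group S\<^esub> free_gen S x = \<one>\<^bsub>free_group S\<^esub>"
      unfolding free_gen_def using that by (subst free_group_mult) auto
    moreover have "word_eq S `` {[(x, False)]} \<in> carrier (free_group S)"
      using that by (auto simp: free_group_def intro: quotientI)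
    ultimately show ?thesis
      using F.inv_equality[of "word_eq S `` {[(x, False)]}" "free_gen S x"] free_gen_closed[OF that] by simp
  qed
  have "word_eq S `` {w} \<in> ?K" if "w \<in> words S" for w
    using that
  proof (induction w)
    case Nil
    then show ?case using generate.one[of "free_group S"] one by metis
  next
    case (Cons p w)
    obtain x b where p: "p = (x, b)" by fastforce
    have x: "x \<in> S" and w: "w \<in> words S" using Cons.prems p by auto
    have "word_eq S `` {[p]} \<in> ?K"
    proof (cases b)
      case True
      then show ?thesis using x p by (auto simp: free_gen_def intro: generate.incl)
    next
      case False
      then show ?thesis using x p neg by (auto intro: generate.inv)
    qed
    then have "word_eq S `` {[p]} \<otimes>\<^bsub>free_group S\<^esub> word_eq S `` {w} \<in> ?K"
      using Cons.IH[OF w] by (rule generate.eng)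
    then show ?case using x w p free_group_mult[of "[p]" S w] by simp
  qed
  then have "carrier (free_group S) \<subseteq> ?K" by (auto simp: free_group_def quotient_def)
  then show ?thesis using F.generate_incl[OF sub] by auto
qed

definition presented_gen :: "'a set \<Rightarrow> ('a \<times> bool) list set set \<Rightarrow> 'a \<Rightarrow> ('a \<times> bool) list set set"
  where "presented_gen S R x = normal_closure (free_group S) R #>\<^bsub>free_group S\<^esub> free_gen S x"

context
  fixes S :: "'a set" and R
  assumes R: "R \<subseteq> carrier (free_group S)"
begin

interpretation F: group "free_group S" by (rule group_free_group)
interpretation N: normal "normal_closure (free_group S) R" "free_group S"
  by (rule F.normal_normal_closure[OF R])

lemma coset_normal_closure_hom:
  "r_coset (free_group S) (normal_closure (free_group S) R) \<in> hom (free_group S) (presented_group S R)"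
  unfolding presented_group_def by (rule N.r_coset_hom_Mod)

lemma presented_gen_closed: "x \<in> S \<Longrightarrow> presented_gen S R x \<in> carrier (presented_group S R)"
  unfolding presented_gen_def
  by (rule hom_in_carrier[OF coset_normal_closure_hom free_gen_closed])

lemma coset_normal_closure_relator:
  assumes "r \<in> R"
  shows "normal_closure (free_group S) R #>\<^bsub>free_group S\<^esub> r = \<one>\<^bsub>presented_group S R\<^esub>"
proof -
  have "r \<in> normal_closure (free_group S) R" using assms by (auto simp: normal_closure_def)
  then show ?thesis unfolding presented_group_def
    by (simp add: F.coset_join2 assms N.subgroup_axioms N.mem_carrier)
qed

lemma generate_presented_gen:
  "generate (presented_group S R) (presented_gen S R ` S) = carrier (presented_group S R)"
proof -
  interpret h: group_hom "free_group S" "presented_group S R"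
    "r_coset (free_group S) (normal_closure (free_group S) R)"
    by (intro group_hom.intro group_free_group group_presented_group[OF R] group_hom_axioms.intro
        coset_normal_closure_hom)
  have "free_gen S ` S \<subseteq> carrier (free_group S)" using free_gen_closed by auto
  from h.generate_img[OF this] show ?thesis
    unfolding generate_free_gen
    by (simp add: image_image presented_gen_def presented_group_def carrier_FactGroup)
qed

text \<open>The extension of \<open>f\<close> to the free group has a normal kernel; once this
  contains \<open>R\<close> it contains the normal closure, and the map descends to the quotient.
  \<open>rel\<close> quantifies over all homomorphisms extending \<open>f\<close> because the
  extension is only obtained inside the proof.\<close>

lemma presented_group_hom:
  assumes H: "group H" and f: "f \<in> S \<rightarrow> carrier H"
    and rel: "\<And>h r. \<lbrakk>h \<in> hom (free_group S) H; \<And>x. x \<in> S \<Longrightarrow> h (free_gen S x) = f x; r \<in> R\<rbrakk>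
      \<Longrightarrow> h r = \<one>\<^bsub>H\<^esub>"
  shows "\<exists>h\<in>hom (presented_group S R) H. \<forall>x\<in>S. h (presented_gen S R x) = f x"
proof -
  obtain h where h: "h \<in> hom (free_group S) H" "\<And>x. x \<in> S \<Longrightarrow> h (free_gen S x) = f x"
    using group.free_group_hom[OF H f] by metis
  interpret h: group_hom "free_group S" H h
    by (intro group_hom.intro group_free_group H group_hom_axioms.intro h)
  have "R \<subseteq> kernel (free_group S) H h" using R rel[OF h] by (auto simp: kernel_def)
  then have "normal_closure (free_group S) R \<subseteq> kernel (free_group S) H h"
    using h.normal_kernel by (auto simp: normal_closure_def)
  then obtain h' where h': "h' \<in> hom (presented_group S R) H"
    "\<And>A. A \<in> carrier (free_group S) \<Longrightarrow>
      h' (normal_closure (free_group S) R #>\<^bsub>free_group S\<^esub> A) = h A"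
    using h.FactGroup_universal_kernel[OF N.normal_axioms] unfolding presented_group_def by metis
  show ?thesis
    using h'(1) by (rule bexI[rotated]) (simp add: presented_gen_def free_gen_closed h' h)
qed

end

section \<open>The equal powers group: generators, relations, universal property\<close>

definition equal_powers_gen :: "nat \<Rightarrow> (nat \<Rightarrow> nat) \<Rightarrow> nat \<Rightarrow> (nat \<times> bool) list set set" where
  "equal_powers_gen m a =
    (let F = free_group {1..m}; x = free_gen {1..m} in
     presented_gen {1..m}
       {(x i [^]\<^bsub>F\<^esub> a i) \<otimes>\<^bsub>F\<^esub> inv\<^bsub>F\<^esub> (x (Suc i) [^]\<^bsub>F\<^esub> a (Suc i)) |i. i \<in> {1..<m}})"

lemma equal_powers_relators_closed:
  "{(free_gen {1..m} i [^]\<^bsub>free_group {1..m}\<^esub> a i) \<otimes>\<^bsub>free_group {1..m}\<^esub>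
      inv\<^bsub>free_group {1..m}\<^esub> (free_gen {1..m} (Suc i) [^]\<^bsub>free_group {1..m}\<^esub> a (Suc i)) |i. i \<in> {1..<m}}
    \<subseteq> carrier (free_group {1..m})" for a :: "nat \<Rightarrow> nat"
proof -
  interpret F: group "free_group {1..m}" by (rule group_free_group)
  have "free_gen {1..m} i [^]\<^bsub>free_group {1..m}\<^esub> a i \<in> carrier (free_group {1..m})"
    if "i \<in> {1..m}" for i
    using that by (intro F.nat_pow_closed free_gen_closed)
  then show ?thesis
    by (intro subsetI) (auto intro!: F.m_closed F.inv_closed simp del: One_nat_def)
qed

lemma equal_powers_gen_closed:
  "i \<in> {1..m} \<Longrightarrow> equal_powers_gen m a i \<in> carrier (equal_powers_group m a)"
  unfolding equal_powers_gen_def equal_powers_group_def Let_def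
  by (intro presented_gen_closed equal_powers_relators_closed)

lemma generate_equal_powers_gen:
  "generate (equal_powers_group m a) (equal_powers_gen m a ` {1..m}) = carrier (equal_powers_group m a)"
  unfolding equal_powers_gen_def equal_powers_group_def Let_def
  by (intro generate_presented_gen equal_powers_relators_closed)

text \<open>The relators compare neighbours only, so the equality is carried along the chain by
  induction from \<open>1\<close> up to \<open>i\<close>.\<close>

lemma equal_powers_gen_pow:
  assumes "i \<in> {1..m}"
  shows "equal_powers_gen m a i [^]\<^bsub>equal_powers_group m a\<^esub> a i =
    equal_powers_gen m a 1 [^]\<^bsub>equal_powers_group m a\<^esub> a 1"
proof -
  let ?F = "free_group {1..m}" and ?x = "free_gen {1..m}" and ?G = "equal_powers_group m a"
  define R where "R = {(?x i [^]\<^bsub>?F\<^esub> a i) \<otimes>\<^bsub>?F\<^esub> inv\<^bsub>?F\<^esub> (?x (Suc i) [^]\<^bsub>?F\<^esub> a (Suc i)) |i. i \<in> {1..<m}}"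
  have R: "R \<subseteq> carrier ?F" unfolding R_def by (rule equal_powers_relators_closed)
  have G: "?G = presented_group {1..m} R" "equal_powers_gen m a = presented_gen {1..m} R"
    by (simp_all add: equal_powers_group_def equal_powers_gen_def R_def Let_def)
  interpret F: group ?F by (rule group_free_group)
  interpret G: group ?G by (rule group_equal_powers_group)
  define c where "c = r_coset ?F (normal_closure ?F R)"
  interpret c: group_hom ?F ?G c
    unfolding c_def G
    by (intro group_hom.intro group_free_group group_presented_group[OF R] group_hom_axioms.intro
        coset_normal_closure_hom[OF R])
  have c_gen: "c (?x i) = equal_powers_gen m a i" for i
    by (simp add: c_def G presented_gen_def)
  have rel: "equal_powers_gen m a i [^]\<^bsub>?G\<^esub> a i = equal_powers_gen m a (Suc i) [^]\<^bsub>?G\<^esub> a (Suc i)"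
    if i: "i \<in> {1..<m}" for i
  proof -
    have x: "?x i \<in> carrier ?F" "?x (Suc i) \<in> carrier ?F"
      using i by (auto intro!: free_gen_closed)
    note X = F.nat_pow_closed[OF x(1), of "a i"] F.nat_pow_closed[OF x(2), of "a (Suc i)"]
    have "(?x i [^]\<^bsub>?F\<^esub> a i) \<otimes>\<^bsub>?F\<^esub> inv\<^bsub>?F\<^esub> (?x (Suc i) [^]\<^bsub>?F\<^esub> a (Suc i)) \<in> R"
      unfolding R_def using i by blast
    from coset_normal_closure_relator[OF R this]
    have "c (?x i [^]\<^bsub>?F\<^esub> a i) \<otimes>\<^bsub>?G\<^esub> inv\<^bsub>?G\<^esub> c (?x (Suc i) [^]\<^bsub>?F\<^esub> a (Suc i)) = \<one>\<^bsub>?G\<^esub>"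
      unfolding c_def[symmetric] G(1)[symmetric] c.hom_mult[OF X(1) F.inv_closed[OF X(2)]] c.hom_inv[OF X(2)] .
    then have "c (?x i [^]\<^bsub>?F\<^esub> a i) = c (?x (Suc i) [^]\<^bsub>?F\<^esub> a (Suc i))"
      by (rule G.eq_if_mult_inv_eq_one[OF c.hom_closed[OF X(1)] c.hom_closed[OF X(2)]])
    then show ?thesis by (simp only: c.hom_nat_pow[OF x(1)] c.hom_nat_pow[OF x(2)] c_gen)
  qed
  from assms have "1 \<le> i" "i \<le> m" by auto
  then show ?thesis
  proof (induction i rule: dec_induct)
    case (step n)
    then show ?case using rel[of n] by fastforce
  qed rule
qed

text \<open>When all the powers have the common value \<open>c\<close>, every relator evaluates to
  \<open>c\<close> times its inverse. The actions on the line are obtained this way.\<close>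

lemma equal_powers_group_hom:
  assumes H: "group H" and f: "f \<in> {1..m} \<rightarrow> carrier H"
    and rel: "\<And>i. i \<in> {1..m} \<Longrightarrow> f i [^]\<^bsub>H\<^esub> a i = c"
  obtains h where "h \<in> hom (equal_powers_group m a) H"
    "\<And>i. i \<in> {1..m} \<Longrightarrow> h (equal_powers_gen m a i) = f i"
proof -
  interpret H: group H by (rule H)
  interpret F: group "free_group {1..m}" by (rule group_free_group)
  define R where "R = {(free_gen {1..m} i [^]\<^bsub>free_group {1..m}\<^esub> a i) \<otimes>\<^bsub>free_group {1..m}\<^esub>
    inv\<^bsub>free_group {1..m}\<^esub> (free_gen {1..m} (Suc i) [^]\<^bsub>free_group {1..m}\<^esub> a (Suc i)) |i. i \<in> {1..<m}}"
  have R: "R \<subseteq> carrier (free_group {1..m})" unfolding R_def by (rule equal_powers_relators_closed)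
  have key: "h r = \<one>\<^bsub>H\<^esub>" if h: "h \<in> hom (free_group {1..m}) H"
    and hx: "\<And>x. x \<in> {1..m} \<Longrightarrow> h (free_gen {1..m} x) = f x" and "r \<in> R" for h r
  proof -
    interpret h: group_hom "free_group {1..m}" H h
      by (intro group_hom.intro group_free_group H group_hom_axioms.intro h)
    obtain i where i: "i \<in> {1..<m}" and r: "r = (free_gen {1..m} i [^]\<^bsub>free_group {1..m}\<^esub> a i) \<otimes>\<^bsub>free_group {1..m}\<^esub>
      inv\<^bsub>free_group {1..m}\<^esub> (free_gen {1..m} (Suc i) [^]\<^bsub>free_group {1..m}\<^esub> a (Suc i))"
      using \<open>r \<in> R\<close> unfolding R_def by blast
    have i': "i \<in> {1..m}" "Suc i \<in> {1..m}" using i by auto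
    note x = free_gen_closed[OF i'(1)] free_gen_closed[OF i'(2)]
    have "f i [^]\<^bsub>H\<^esub> a i \<in> carrier H" using f i' by (intro H.nat_pow_closed) auto
    then have "f i [^]\<^bsub>H\<^esub> a i \<otimes>\<^bsub>H\<^esub> inv\<^bsub>H\<^esub> (f (Suc i) [^]\<^bsub>H\<^esub> a (Suc i)) = \<one>\<^bsub>H\<^esub>"
      unfolding rel[OF i'(1)] rel[OF i'(2)] by simp
    then show ?thesis
      unfolding r hx[OF i'(1), symmetric] hx[OF i'(2), symmetric] using x
      by (simp only: h.hom_mult h.hom_inv h.hom_nat_pow F.nat_pow_closed F.inv_closed)
  qed
  have "\<exists>h\<in>hom (presented_group {1..m} R) H. \<forall>i\<in>{1..m}. h (presented_gen {1..m} R i) = f i"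
    by (rule presented_group_hom[OF R H f]) (rule key; simp)
  then obtain h where h: "h \<in> hom (presented_group {1..m} R) H"
    "\<And>i. i \<in> {1..m} \<Longrightarrow> h (presented_gen {1..m} R i) = f i"
    by blast
  show thesis
  proof (rule that)
    show "h \<in> hom (equal_powers_group m a) H"
      using h(1) by (simp only: R_def equal_powers_group_def Let_def)
    show "h (equal_powers_gen m a i) = f i" if "i \<in> {1..m}" for i
      using h(2)[OF that] by (simp only: R_def equal_powers_gen_def Let_def)
  qed
qed

section \<open>Roots of the unit translation of the line\<close>

text \<open>The target of actions by order automorphisms; on a linear order, strict monotonicity
  supplies the injectivity.\<close>

definition order_auts :: "('a::linorder \<Rightarrow> 'a) monoid"
  where "order_auts = \<lparr>carrier = {f. strict_mono f \<and> surj f}, monoid.mult = (\<circ>), monoid.one = id\<rparr>"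

lemma order_auts_simps [simp]:
  "carrier order_auts = {f. strict_mono f \<and> surj f}"
  "f \<otimes>\<^bsub>order_auts\<^esub> g = f \<circ> g"
  "\<one>\<^bsub>order_auts\<^esub> = id"
  by (simp_all add: order_auts_def)

lemma group_order_auts: "group (order_auts :: ('a::linorder \<Rightarrow> 'a) monoid)"
proof (rule groupI)
  fix f :: "'a \<Rightarrow> 'a" assume "f \<in> carrier order_auts"
  then have f: "strict_mono f" "surj f" by auto
  then have inj: "inj f" by (simp add: strict_mono_imp_inj_on)
  have "strict_mono (inv_into UNIV f)"
  proof (rule strict_monoI)
    fix x y :: 'a assume "x < y"
    then have "f (inv_into UNIV f x) < f (inv_into UNIV f y)" by (simp add: f surj_f_inv_f)
    then show "inv_into UNIV f x < inv_into UNIV f y" using f by (simp add: strict_mono_less)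
  qed
  then show "\<exists>g\<in>carrier order_auts. g \<otimes>\<^bsub>order_auts\<^esub> f = \<one>\<^bsub>order_auts\<^esub>"
    using inj by (intro bexI[of _ "inv_into UNIV f"]) (auto simp: inj_imp_surj_inv)
next
  show "f \<otimes>\<^bsub>order_auts\<^esub> g \<in> carrier order_auts"
    if "f \<in> carrier order_auts" "g \<in> carrier order_auts" for f g :: "'a \<Rightarrow> 'a"
    using that comp_surj[of g f] strict_mono_o[of f g] by (simp add: o_def)
qed (auto simp: strict_mono_def)

lemma order_auts_pow: "f [^]\<^bsub>order_auts\<^esub> (n::nat) = f ^^ n"
  by (induction n) (auto simp: nat_pow_def funpow_swap1)

text \<open>Each interval \<open>[n, n + 1)\<close> with integer \<open>n\<close> carries a copy of
  the power map on \<open>[0, 1)\<close>. Since \<open>0 powr \<kappa> = 0\<close>, integers are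
  fixed. The map commutes with the unit translation, and for positive \<open>\<kappa>\<close> its
  inverse has exponent \<open>1 / \<kappa>\<close>.\<close>

definition frac_powr :: "real \<Rightarrow> real \<Rightarrow> real"
  where "frac_powr \<kappa> t = of_int \<lfloor>t\<rfloor> + frac t powr \<kappa>"

lemma floor_frac_powr: "\<kappa> > 0 \<Longrightarrow> \<lfloor>frac_powr \<kappa> t\<rfloor> = \<lfloor>t\<rfloor>"
  and frac_frac_powr: "\<kappa> > 0 \<Longrightarrow> frac (frac_powr \<kappa> t) = frac t powr \<kappa>"
proof -
  assume "\<kappa> > 0"
  then have "frac t powr \<kappa> < 1"
    using powr_less_mono2[of \<kappa> "frac t" 1] by (simp add: frac_lt_1)
  then show *: "\<lfloor>frac_powr \<kappa> t\<rfloor> = \<lfloor>t\<rfloor>" by (simp add: frac_powr_def floor_eq_iff)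
  then show "frac (frac_powr \<kappa> t) = frac t powr \<kappa>" by (simp add: frac_def) (simp add: frac_powr_def frac_def)
qed

lemma frac_powr_inverse: "\<kappa> > 0 \<Longrightarrow> frac_powr (1 / \<kappa>) (frac_powr \<kappa> t) = t"
  by (subst frac_powr_def) (simp add: floor_frac_powr frac_frac_powr powr_powr, simp add: frac_def)

lemma frac_powr_add_1: "frac_powr \<kappa> (t + 1) = frac_powr \<kappa> t + 1"
  by (simp add: frac_powr_def frac_def)

lemma strict_mono_frac_powr:
  assumes "\<kappa> > 0" shows "strict_mono (frac_powr \<kappa>)"
proof (rule strict_monoI)
  fix s t :: real assume "s < t"
  show "frac_powr \<kappa> s < frac_powr \<kappa> t"
  proof (cases "\<lfloor>s\<rfloor> = \<lfloor>t\<rfloor>")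
    case True
    then have "frac s < frac t" using \<open>s < t\<close> by (simp add: frac_def)
    then show ?thesis using True assms by (simp add: frac_powr_def powr_less_mono2)
  next
    case False
    then have "\<lfloor>s\<rfloor> < \<lfloor>t\<rfloor>" using \<open>s < t\<close> by (simp add: floor_mono order_less_le)
    then have "\<lfloor>frac_powr \<kappa> s\<rfloor> < \<lfloor>frac_powr \<kappa> t\<rfloor>" by (simp add: floor_frac_powr assms)
    then show ?thesis using floor_less_cancel by blast
  qed
qed

text \<open>
  The translation by \<open>1 / a\<close>, conjugated by \<^term>\<open>frac_powr \<kappa>\<close>, sends \<open>0\<close> to
  \<open>(1 / a) powr \<kappa>\<close>, and a suitable \<open>\<kappa>\<close> makes this equal to \<open>s\<close>.
\<close>

lemma root_of_translation:
  assumes a: "a > (1::nat)" and s: "0 < s" "s < (1::real)"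
  obtains f where "strict_mono f" "surj f" "\<And>t. (f ^^ a) t = t + 1" "f p = p + s"
proof -
  \<comment> \<open>This makes \<open>(1 / a) powr \<kappa>\<close> equal to \<open>s\<close>; it is
    positive because \<open>s < 1 < a\<close>.\<close>
  define \<kappa> where "\<kappa> = - log a s"
  have \<kappa>: "\<kappa> > 0" using a s by (simp add: \<kappa>_def)
  define f where "f t = p + frac_powr \<kappa> (frac_powr (1 / \<kappa>) (t - p) + 1 / a)" for t
  have pow: "(f ^^ n) t = p + frac_powr \<kappa> (frac_powr (1 / \<kappa>) (t - p) + n / a)" for n t
    using frac_powr_inverse[of "1 / \<kappa>"] \<kappa>
    by (induction n) (simp_all add: f_def frac_powr_inverse add_divide_distrib add_ac)
  show thesis
  proof
    show "strict_mono f"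
      using strict_mono_frac_powr[OF \<kappa>] strict_mono_frac_powr[of "1 / \<kappa>"] \<kappa>
      by (auto simp: f_def strict_mono_def)
    show pow_a: "(f ^^ a) t = t + 1" for t
      using frac_powr_inverse[of "1 / \<kappa>"] \<kappa> a by (simp add: pow frac_powr_add_1)
    show "surj f"
    \<comment> \<open>As \<open>f ^^ a\<close> is the unit translation, a right inverse of
      \<open>f\<close> is \<open>f ^^ (a - 1)\<close> applied after the shift by
      \<open>-1\<close>.\<close>
    proof (rule surjI[of _ "\<lambda>t. (f ^^ (a - 1)) (t - 1)"])
      show "f ((f ^^ (a - 1)) (t - 1)) = t" for t
        using pow_a[of "t - 1"] a by (cases a) auto
    qed
    have "frac (1 / real a) = 1 / real a" "\<lfloor>1 / real a\<rfloor> = 0"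
      using a by (auto simp: frac_eq floor_eq_iff)
    moreover have "(1 / real a) powr \<kappa> = s"
      using a s by (simp add: \<kappa>_def powr_minus powr_divide field_simps)
    ultimately show "f p = p + s"
      by (simp add: f_def frac_powr_def)
  qed
qed

section \<open>The positive cone\<close>

lemma (in group) inv_mult_cancel_left [simp]:
  "\<lbrakk>u \<in> carrier G; v \<in> carrier G\<rbrakk> \<Longrightarrow> inv u \<otimes> (u \<otimes> v) = v"
  "\<lbrakk>u \<in> carrier G; v \<in> carrier G\<rbrakk> \<Longrightarrow> u \<otimes> (inv u \<otimes> v) = v"
  by (simp_all add: m_assoc[symmetric])

lemma (in group) inv_commute:
  assumes "u \<in> carrier G" "v \<in> carrier G" "u \<otimes> v = v \<otimes> u"
  shows "inv u \<otimes> v = v \<otimes> inv u"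
proof -
  have "inv u \<otimes> v = inv u \<otimes> (v \<otimes> u) \<otimes> inv u" using assms by (simp add: m_assoc)
  also have "\<dots> = v \<otimes> inv u" using assms by (simp add: m_assoc flip: assms(3))
  finally show ?thesis .
qed

text \<open>Indices start at \<open>0\<close>, and \<open>x\<close> and \<open>a\<close> are
  parameters, so that every reordering of the generators is another instance on the same group with
  the same \<open>z\<close>.\<close>

locale equal_powers = group G for G (structure) +
  fixes x :: "nat \<Rightarrow> 'a" and a :: "nat \<Rightarrow> nat" and m :: nat and z :: 'a
  assumes m_pos: "0 < m"
    and x_closed [simp]: "i < m \<Longrightarrow> x i \<in> carrier G"
    and a_gt_1: "i < m \<Longrightarrow> 1 < a i"
    and x_pow_a: "i < m \<Longrightarrow> x i [^] a i = z"
    and generate_x: "generate G (x ` {..<m}) = carrier G"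
begin

lemma z_closed [simp]: "z \<in> carrier G"
  using x_pow_a[OF m_pos] m_pos by auto

text \<open>\<open>z\<close> is a power of every generator, hence commutes with the generators and
  their inverses.\<close>

lemma z_commute: "u \<in> carrier G \<Longrightarrow> z \<otimes> u = u \<otimes> z"
  unfolding generate_x[symmetric]
proof (induction rule: generate.induct)
  case one
  then show ?case by simp
next
  case (incl u)
  then obtain i where "i < m" "u = x i" by auto
  then show ?case using x_pow_a[of i] nat_pow_comm[of "x i" "a i" 1] by simp
next
  case (inv u)
  then obtain i where i: "i < m" "u = x i" by auto
  then have "z \<otimes> u = u \<otimes> z" using x_pow_a[of i] nat_pow_comm[of "x i" "a i" 1] by simp
  then show ?case using i inv_commute[of u z] by simp
next
  case (eng u v)
  then have "u \<in> carrier G" "v \<in> carrier G" by (simp_all add: generate_x)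
  then show ?case using eng by (metis m_assoc z_closed)
qed

lemma z_pow_commute: "u \<in> carrier G \<Longrightarrow> z [^] (k::int) \<otimes> u = u \<otimes> z [^] k"
proof -
  assume u: "u \<in> carrier G"
  have nat: "z [^] (n::nat) \<otimes> u = u \<otimes> z [^] n" for n
    using u z_commute by (simp add: group_commutes_pow)
  have neg: "inv (z [^] n) \<otimes> u = u \<otimes> inv (z [^] n)" for n :: nat
    using nat[of n] u by (intro inv_commute) auto
  show ?thesis unfolding int_pow_def2 using nat[of "nat k"] neg[of "nat (- k)"] by (cases "k < 0") simp_all
qed

lemma z_pow_left_commute:
  "\<lbrakk>u \<in> carrier G; v \<in> carrier G\<rbrakk> \<Longrightarrow> u \<otimes> (z [^] (k::int) \<otimes> v) = z [^] k \<otimes> (u \<otimes> v)"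
  by (metis m_assoc z_pow_commute int_pow_closed z_closed)

lemma z_pow_z_pow:
  "u \<in> carrier G \<Longrightarrow> z [^] (k::int) \<otimes> (z [^] (l::int) \<otimes> u) = z [^] (k + l) \<otimes> u"
  by (simp add: m_assoc[symmetric] int_pow_mult)

definition xprod :: "nat list \<Rightarrow> 'a"
  where "xprod l = foldr (\<lambda>i t. x i \<otimes> t) l \<one>"

lemma xprod_Nil [simp]: "xprod [] = \<one>"
  and xprod_Cons [simp]: "xprod (i # l) = x i \<otimes> xprod l"
  by (simp_all add: xprod_def)

lemma xprod_closed [simp]: "set l \<subseteq> {..<m} \<Longrightarrow> xprod l \<in> carrier G"
  by (induction l) auto

text \<open>
  In the model, \<open>x i\<close> lifts a rotation by \<open>2 \<pi> / a i\<close> about the \<open>i\<close>-th of \<open>m\<close> cone points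
  of a disk, \<open>z\<close> is the full turn and \<open>g 0\<close> is the boundary translation, which turns out to
  be the least positive element.
\<close>

definition g :: "nat \<Rightarrow> 'a"
  where "g i = z [^] (1 - (int m - int i)) \<otimes> xprod [i..<m]"

lemma g_closed [simp]: "g i \<in> carrier G"
  by (simp add: g_def subset_iff)

lemma g_m [simp]: "g m = z"
  by (simp add: g_def)

lemma z_g: "i < m \<Longrightarrow> z \<otimes> g i = x i \<otimes> g (Suc i)"
proof -
  assume i: "i < m"
  have P: "xprod [Suc i..<m] \<in> carrier G" by (simp add: subset_iff)
  have "z \<otimes> g i = z [^] (1::int) \<otimes> g i" by simp
  also have "\<dots> = z [^] (1 - (int m - int (Suc i))) \<otimes> (x i \<otimes> xprod [Suc i..<m])"
    unfolding g_def using i P by (simp add: z_pow_z_pow upt_conv_Cons del: int_pow_1 of_nat_Suc)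
      (simp add: algebra_simps)
  also have "\<dots> = x i \<otimes> g (Suc i)" using i P by (simp add: g_def z_pow_left_commute)
  finally show ?thesis .
qed

text \<open>By \<open>z_g\<close>, \<open>x i \<otimes> g (Suc i)\<close> equals
  \<open>x i [^] a i \<otimes> g i\<close>, and one factor \<open>x i\<close> cancels. The later
  comparisons between different \<open>g i\<close> rest on this.\<close>

lemma g_Suc: "i < m \<Longrightarrow> g (Suc i) = x i [^] (a i - 1) \<otimes> g i"
proof -
  assume i: "i < m"
  then have "x i [^] a i = x i \<otimes> x i [^] (a i - 1)"
    using a_gt_1[OF i] nat_pow_Suc2[of "x i" "a i - 1"] by simp
  then have "x i \<otimes> g (Suc i) = x i \<otimes> x i [^] (a i - 1) \<otimes> g i"
    using z_g[OF i] x_pow_a[OF i] by metis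
  then show ?thesis using i by (simp add: m_assoc)
qed

section \<open>The monoid \<open>M\<close> and its left invariant preorder\<close>

inductive_set M where
  M_one: "\<one> \<in> M"
| M_step: "\<lbrakk>i < m; u \<in> M\<rbrakk> \<Longrightarrow> g i \<otimes> u \<in> M"

lemma M_closed [simp]: "u \<in> M \<Longrightarrow> u \<in> carrier G"
  by (induction rule: M.induct) auto

lemma M_mult: "\<lbrakk>u \<in> M; v \<in> M\<rbrakk> \<Longrightarrow> u \<otimes> v \<in> M"
  by (induction rule: M.induct) (auto simp: m_assoc intro: M_step)

lemma M_pow: "u \<in> M \<Longrightarrow> u [^] (n::nat) \<in> M"
  by (induction n) (auto intro: M_one M_mult)

lemma g_in_M: "i < m \<Longrightarrow> g i \<in> M"
  using M_step[OF _ M_one] by simp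

text \<open>Only a preorder for now: antisymmetry has to wait until \<open>M\<close> is known to
  contain no nontrivial element together with its inverse.\<close>

definition le :: "'a \<Rightarrow> 'a \<Rightarrow> bool"  (infix "\<preceq>" 50)
  where "u \<preceq> v \<longleftrightarrow> u \<in> carrier G \<and> v \<in> carrier G \<and> inv u \<otimes> v \<in> M"

lemma le_carrier: "u \<preceq> v \<Longrightarrow> u \<in> carrier G" "u \<preceq> v \<Longrightarrow> v \<in> carrier G"
  by (simp_all add: le_def)

lemma le_refl: "u \<in> carrier G \<Longrightarrow> u \<preceq> u"
  by (simp add: le_def M_one)

lemma le_trans [trans]: "\<lbrakk>u \<preceq> v; v \<preceq> w\<rbrakk> \<Longrightarrow> u \<preceq> w"
proof -
  assume *: "u \<preceq> v" "v \<preceq> w"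
  then have "inv u \<otimes> v \<otimes> (inv v \<otimes> w) \<in> M" by (auto simp: le_def intro: M_mult)
  moreover have "inv u \<otimes> v \<otimes> (inv v \<otimes> w) = inv u \<otimes> w"
    using * by (simp add: le_def m_assoc)
  ultimately show ?thesis using * by (simp add: le_def)
qed

lemma le_mult_left: "\<lbrakk>w \<in> carrier G; u \<preceq> v\<rbrakk> \<Longrightarrow> w \<otimes> u \<preceq> w \<otimes> v"
proof -
  assume *: "w \<in> carrier G" "u \<preceq> v"
  then have "inv (w \<otimes> u) \<otimes> (w \<otimes> v) = inv u \<otimes> (inv w \<otimes> (w \<otimes> v))"
    by (simp add: le_def inv_mult_group m_assoc)
  also have "\<dots> = inv u \<otimes> v" using * by (simp add: le_def)
  finally show ?thesis using * by (simp add: le_def)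
qed

lemma one_le_iff: "\<one> \<preceq> u \<longleftrightarrow> u \<in> M"
  by (auto simp: le_def)

lemma le_mult_M: "\<lbrakk>u \<in> carrier G; w \<in> M\<rbrakk> \<Longrightarrow> u \<preceq> u \<otimes> w"
  using le_mult_left[of u \<one> w] by (simp add: one_le_iff)

lemma M_upward: "\<lbrakk>u \<in> M; u \<preceq> v\<rbrakk> \<Longrightarrow> v \<in> M"
  using le_trans one_le_iff by blast

text \<open>Downward induction from \<open>g m = z\<close>. With
  \<open>z = g (Suc n) \<otimes> t\<close> and \<open>t \<in> M\<close>, \<open>z_g\<close> gives
  \<open>x n = g n \<otimes> t\<close>. So \<open>g n \<preceq> x n\<close>, and \<open>x n\<close>
  lies in \<open>M\<close>, hence below its own power \<open>z\<close>.\<close>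

lemma g_le_z_and_g_le_x: "i \<le> m \<Longrightarrow> g i \<preceq> z \<and> (i < m \<longrightarrow> g i \<preceq> x i)"
proof (induction i rule: inc_induct)
  case base
  then show ?case by (simp add: le_refl)
next
  case (step n)
  define t where "t = inv (g (Suc n)) \<otimes> z"
  have t: "t \<in> M" using step by (simp add: le_def t_def)
  have "g n \<otimes> t = z \<otimes> g n \<otimes> inv (g (Suc n))"
    by (simp add: t_def m_assoc z_commute)
  also have "\<dots> = x n" using step by (simp add: z_g m_assoc)
  finally have x: "x n = g n \<otimes> t" ..
  have "x n \<in> M" unfolding x using step t by (intro M_mult g_in_M)
  then have "x n \<preceq> x n \<otimes> x n [^] (a n - 1)" using step by (intro le_mult_M M_pow) auto
  also have "x n \<otimes> x n [^] (a n - 1) = z"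
    using step a_gt_1[of n] x_pow_a[of n] nat_pow_Suc2[of "x n" "a n - 1"] by simp
  finally have "x n \<preceq> z" .
  moreover have "g n \<preceq> x n" using t le_mult_M[of "g n" t] x by simp
  ultimately show ?case using le_trans by blast
qed

lemma g_le_z: "i \<le> m \<Longrightarrow> g i \<preceq> z"
  and g_le_x: "i < m \<Longrightarrow> g i \<preceq> x i"
  using g_le_z_and_g_le_x by auto

lemma x_in_M: "i < m \<Longrightarrow> x i \<in> M"
  using M_upward g_in_M g_le_x by blast

lemma z_in_M: "z \<in> M"
  using m_pos x_in_M M_pow x_pow_a by metis

lemma z_pow_in_M: "k \<ge> 0 \<Longrightarrow> z [^] (k::int) \<in> M"
  by (metis M_pow z_in_M pow_nat)

text \<open>Only left multiplication preserves the preorder, so the step multiplies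
  \<open>g i \<preceq> x i \<preceq> x i \<otimes> g i\<close> on the left by
  \<open>x i [^] n\<close>.\<close>

lemma g_le_x_pow_g: "i < m \<Longrightarrow> g i \<preceq> x i [^] (n::nat) \<otimes> g i"
proof (induction n)
  case (Suc n)
  have "g i \<preceq> x i \<otimes> g i"
    using Suc le_trans[OF g_le_x le_mult_M] g_in_M by simp
  then have "x i [^] n \<otimes> g i \<preceq> x i [^] n \<otimes> (x i \<otimes> g i)" using Suc by (intro le_mult_left) auto
  then have "x i [^] n \<otimes> g i \<preceq> x i [^] Suc n \<otimes> g i" using Suc by (simp add: m_assoc)
  with Suc show ?case using le_trans by blast
qed (simp add: le_refl)

lemma x_pow_g_mono: "\<lbrakk>i < m; n \<le> k\<rbrakk> \<Longrightarrow> x i [^] (n::nat) \<otimes> g i \<preceq> x i [^] k \<otimes> g i"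
proof -
  assume *: "i < m" "n \<le> k"
  then have "x i [^] n \<otimes> g i \<preceq> x i [^] n \<otimes> (x i [^] (k - n) \<otimes> g i)"
    by (intro le_mult_left g_le_x_pow_g) auto
  also have "\<dots> = x i [^] k \<otimes> g i" using * by (simp add: m_assoc[symmetric] nat_pow_mult)
  finally show ?thesis .
qed

lemma g_mono: "\<lbrakk>i \<le> j; j \<le> m\<rbrakk> \<Longrightarrow> g i \<preceq> g j"
proof (induction j rule: dec_induct)
  case (step n)
  then have "g n \<preceq> g (Suc n)" using g_le_x_pow_g[of n "a n - 1"] by (simp add: g_Suc)
  then show ?case using step le_trans by auto
qed (simp add: le_refl)

text \<open>
  The intervals \<open>[g i, g (i + 1)]\<close> are the ping-pong domains: a nontrivial power of \<open>x i\<close> maps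
  the \<open>j\<close>-th one into the \<open>i\<close>-th one if \<open>j < i\<close>, and into its translate by \<open>z\<close> if \<open>i < j\<close>.
\<close>

definition D :: "nat \<Rightarrow> 'a set"
  where "D i = {u. g i \<preceq> u \<and> u \<preceq> g (Suc i)}"

lemma D_dest:
  assumes "u \<in> D i"
  shows "g i \<preceq> u" "u \<preceq> g (Suc i)" "u \<in> carrier G"
proof -
  show "g i \<preceq> u" "u \<preceq> g (Suc i)" using assms unfolding D_def by blast+
  then show "u \<in> carrier G" by (blast dest: le_carrier)
qed

lemma x_pow_le: "\<lbrakk>i < m; e < a i\<rbrakk> \<Longrightarrow> x i [^] e \<preceq> g (Suc i)"
proof -
  assume *: "i < m" "e < a i"
  then have "x i [^] e \<preceq> x i [^] e \<otimes> g i" by (intro le_mult_M g_in_M) auto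
  also have "\<dots> \<preceq> x i [^] (a i - 1) \<otimes> g i" using * by (intro x_pow_g_mono) auto
  finally show ?thesis using * by (simp add: g_Suc)
qed

lemma x_pow_in_D: "\<lbrakk>i < m; 0 < e; e < a i\<rbrakk> \<Longrightarrow> x i [^] e \<in> D i"
proof -
  assume *: "i < m" "0 < e" "e < a i"
  have "x i \<preceq> x i \<otimes> x i [^] (e - 1)" using * by (intro le_mult_M M_pow x_in_M) auto
  also have "\<dots> = x i [^] e" using * nat_pow_Suc2[of "x i" "e - 1"] by simp
  finally show ?thesis using * g_le_x[of i] le_trans x_pow_le by (auto simp: D_def)
qed

text \<open>Here \<open>g (Suc i) \<preceq> u \<preceq> z\<close>. Applying \<open>x i [^] e\<close>
  and removing \<open>z\<close> turns the lower end into
  \<open>x i [^] (e - 1) \<otimes> g i\<close>, by \<open>z_g\<close>, and the upper end into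
  \<open>x i [^] e\<close>; both lie in \<open>D i\<close> or above its left end as
  required.\<close>

lemma D_ascent:
  assumes ij: "i < j" "j < m" and u: "u \<in> D j" and e: "0 < e" "e < a i"
  shows "z [^] (-1::int) \<otimes> (x i [^] e \<otimes> u) \<in> D i"
proof -
  have i: "i < m" using ij by simp
  have u': "g j \<preceq> u" "u \<preceq> g (Suc j)" "u \<in> carrier G" using u by (fact D_dest)+
  have "x i [^] e = x i [^] (e - 1) \<otimes> x i" using e nat_pow_Suc[of "x i" "e - 1"] by simp
  then have "x i [^] e \<otimes> g (Suc i) = x i [^] (e - 1) \<otimes> (z [^] (1::int) \<otimes> g i)"
    using i z_g[OF i] by (simp add: m_assoc)
  also have "\<dots> = z [^] (1::int) \<otimes> (x i [^] (e - 1) \<otimes> g i)"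
    using i by (intro z_pow_left_commute) auto
  finally have eq: "z [^] (-1::int) \<otimes> (x i [^] e \<otimes> g (Suc i)) = x i [^] (e - 1) \<otimes> g i"
    using i by (simp add: z_pow_z_pow del: int_pow_1)
  have "g i \<preceq> x i [^] (e - 1) \<otimes> g i" using i by (rule g_le_x_pow_g)
  also have "\<dots> \<preceq> z [^] (-1::int) \<otimes> (x i [^] e \<otimes> u)"
    unfolding eq[symmetric] using i ij u' by (intro le_mult_left le_trans[OF g_mono[of "Suc i" j]]) auto
  finally have lower: "g i \<preceq> z [^] (-1::int) \<otimes> (x i [^] e \<otimes> u)" .
  have "z [^] (-1::int) \<otimes> (x i [^] e \<otimes> u) \<preceq> z [^] (-1::int) \<otimes> (x i [^] e \<otimes> z)"
    using i ij u' by (intro le_mult_left le_trans[OF _ g_le_z[of "Suc j"]]) auto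
  also have "\<dots> = z [^] (-1::int) \<otimes> (z [^] (1::int) \<otimes> x i [^] e)"
    using i by (simp add: z_commute)
  also have "\<dots> = x i [^] e" using i by (simp add: z_pow_z_pow del: int_pow_1)
  also have "\<dots> \<preceq> g (Suc i)" using i e by (simp add: x_pow_le)
  finally show ?thesis using lower by (simp add: D_def)
qed

text \<open>Here \<open>u \<in> M\<close> and \<open>u \<preceq> g i\<close>, so the image lies
  between \<open>x i [^] e\<close> and \<open>x i [^] e \<otimes> g i\<close>, and
  \<open>g_Suc\<close> bounds the latter by \<open>g (Suc i)\<close>.\<close>

lemma D_descent:
  assumes ij: "j < i" "i < m" and u: "u \<in> D j" and e: "0 < e" "e < a i"
  shows "x i [^] e \<otimes> u \<in> D i"
proof -
  have u': "g j \<preceq> u" "u \<preceq> g (Suc j)" "u \<in> carrier G" using u by (fact D_dest)+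
  have "u \<in> M" using M_upward[OF g_in_M u'(1)] ij by simp
  then have "x i [^] e \<preceq> x i [^] e \<otimes> u" using ij by (intro le_mult_M) auto
  then have lower: "g i \<preceq> x i [^] e \<otimes> u"
    using x_pow_in_D[of i e] e ij le_trans by (auto simp: D_def)
  have "x i [^] e \<otimes> u \<preceq> x i [^] e \<otimes> g i"
    using ij u' by (intro le_mult_left le_trans[OF _ g_mono[of "Suc j" i]]) auto
  also have "\<dots> \<preceq> g (Suc i)" using ij e by (simp add: g_Suc x_pow_g_mono)
  finally show ?thesis using lower by (simp add: D_def)
qed

text \<open>The index is that of the leftmost syllable, which selects the ping-pong domain. Full
  powers \<open>x i [^] a i\<close> are excluded since they equal the central
  \<open>z\<close>.\<close>

inductive alternating :: "nat \<Rightarrow> 'a \<Rightarrow> bool" where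
  single: "\<lbrakk>i < m; 0 < e; e < a i\<rbrakk> \<Longrightarrow> alternating i (x i [^] e)"
| cons: "\<lbrakk>alternating j u; i \<noteq> j; i < m; 0 < e; e < a i\<rbrakk> \<Longrightarrow> alternating i (x i [^] e \<otimes> u)"

text \<open>Ping-pong from the rightmost syllable: each further syllable lands in its own domain,
  after removal of one \<open>z\<close> at every ascent of the indices.\<close>

lemma alternating_D: "alternating i u \<Longrightarrow> i < m \<and> u \<in> carrier G \<and> (\<exists>k::int. z [^] k \<otimes> u \<in> D i)"
proof (induction rule: alternating.induct)
  case (single i e)
  then have "z [^] (0::int) \<otimes> x i [^] e \<in> D i" using x_pow_in_D by simp
  moreover have "x i [^] e \<in> carrier G" using single by simp
  ultimately show ?case using single by blast
next
  case (cons j u i e)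
  then have xu: "x i [^] e \<otimes> u \<in> carrier G" by simp
  from cons obtain k :: int where k: "z [^] k \<otimes> u \<in> D j" by blast
  have eq: "x i [^] e \<otimes> (z [^] k \<otimes> u) = z [^] k \<otimes> (x i [^] e \<otimes> u)"
    using cons by (simp add: z_pow_left_commute)
  show ?case
  proof (cases "i < j")
    case True
    then have "z [^] (-1 + k) \<otimes> (x i [^] e \<otimes> u) \<in> D i"
      using D_ascent[OF _ _ k, of i e] cons by (simp add: eq z_pow_z_pow)
    then show ?thesis using cons xu by blast
  next
    case False
    then have "z [^] k \<otimes> (x i [^] e \<otimes> u) \<in> D i"
      using D_descent[OF _ _ k, of i e] cons eq by simp
    then show ?thesis using cons xu by blast
  qed
qed

section \<open>Normal forms and totality of the cone\<close>

definition normal_forms :: "'a set"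
  where "normal_forms = {z [^] (k::int) \<otimes> u |k u. u = \<one> \<or> (\<exists>i. alternating i u)}"

lemma normal_formsI: "u = \<one> \<or> (\<exists>i. alternating i u) \<Longrightarrow> z [^] (k::int) \<otimes> u \<in> normal_forms"
  by (auto simp: normal_forms_def)

lemma normal_forms_carrier: "v \<in> normal_forms \<Longrightarrow> v \<in> carrier G"
  using alternating_D by (auto simp: normal_forms_def)

lemma z_pow_normal_forms: "v \<in> normal_forms \<Longrightarrow> z [^] (k::int) \<otimes> v \<in> normal_forms"
proof -
  assume "v \<in> normal_forms"
  then obtain l :: int and u where u: "v = z [^] l \<otimes> u" "u = \<one> \<or> (\<exists>i. alternating i u)"
    by (auto simp: normal_forms_def)
  then have "u \<in> carrier G" using alternating_D by auto
  then have "z [^] k \<otimes> v = z [^] (k + l) \<otimes> u" using u by (simp add: z_pow_z_pow)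
  then show ?thesis using u normal_formsI by simp
qed

text \<open>Powers of \<open>z\<close> move to the front. A different generator opens a new
  syllable, an equal one raises the leading exponent, and when this reaches \<open>a i\<close> the
  syllable turns into \<open>z\<close> and only the tail remains.\<close>

lemma x_normal_forms:
  assumes i: "i < m" and v: "v \<in> normal_forms" shows "x i \<otimes> v \<in> normal_forms"
proof -
  obtain l :: int and u where u: "v = z [^] l \<otimes> u" "u = \<one> \<or> (\<exists>i. alternating i u)"
    using v by (auto simp: normal_forms_def)
  then have uc: "u \<in> carrier G" using alternating_D by auto
  have "x i \<otimes> u \<in> normal_forms"
  proof (cases "u = \<one>")
    case True
    have "alternating i (x i [^] (1::nat))" using i a_gt_1[OF i] by (intro single) auto
    then have "z [^] (0::int) \<otimes> (x i [^] (1::nat)) \<in> normal_forms" by (intro normal_formsI) blast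
    then show ?thesis using True i by simp
  next
    case False
    then obtain j where "alternating j u" using u by blast
    then show ?thesis
    proof cases
      case (single e)
      have x: "x i \<otimes> x i [^] e = x i [^] Suc e" using i by (simp only: nat_pow_Suc2 x_closed)
      consider "i \<noteq> j" | "i = j" "Suc e < a i" | "i = j" "Suc e = a i"
        using \<open>e < a j\<close> by (metis Suc_lessI)
      then show ?thesis
      proof cases
        case 1
        then have "alternating i (x i [^] (1::nat) \<otimes> u)"
          using \<open>alternating j u\<close> i a_gt_1[OF i] by (intro cons) auto
        then have "z [^] (0::int) \<otimes> (x i [^] (1::nat) \<otimes> u) \<in> normal_forms" by (intro normal_formsI) blast
        then show ?thesis using i uc by simp
      next
        case 2
        then have "alternating i (x i [^] Suc e)" using i by (intro alternating.single) auto
        then have "z [^] (0::int) \<otimes> (x i [^] Suc e) \<in> normal_forms" by (intro normal_formsI) blast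
        then show ?thesis using single 2 i x by simp
      next
        case 3
        have "z [^] (1::int) \<otimes> \<one> \<in> normal_forms" by (intro normal_formsI) blast
        then show ?thesis using single 3 i x x_pow_a by simp
      qed
    next
      case (cons k w e)
      have w: "w \<in> carrier G" using cons alternating_D by blast
      have x: "x i \<otimes> (x i [^] e \<otimes> w) = x i [^] Suc e \<otimes> w"
        using i w by (simp only: nat_pow_Suc2 x_closed m_assoc nat_pow_closed)
      consider "i \<noteq> j" | "i = j" "Suc e < a i" | "i = j" "Suc e = a i"
        using \<open>e < a j\<close> by (metis Suc_lessI)
      then show ?thesis
      proof cases
        case 1
        then have "alternating i (x i [^] (1::nat) \<otimes> u)"
          using \<open>alternating j u\<close> i a_gt_1[OF i] by (intro alternating.cons) auto
        then have "z [^] (0::int) \<otimes> (x i [^] (1::nat) \<otimes> u) \<in> normal_forms" by (intro normal_formsI) blast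
        then show ?thesis using i uc by simp
      next
        case 2
        then have "alternating i (x i [^] Suc e \<otimes> w)" using cons i by (intro alternating.cons) auto
        then have "z [^] (0::int) \<otimes> (x i [^] Suc e \<otimes> w) \<in> normal_forms" by (intro normal_formsI) blast
        then show ?thesis using cons 2 i x w by simp
      next
        case 3
        have "z [^] (1::int) \<otimes> w \<in> normal_forms" using cons by (intro normal_formsI) blast
        then show ?thesis using cons 3 i x x_pow_a by simp
      qed
    qed
  qed
  then have "z [^] l \<otimes> (x i \<otimes> u) \<in> normal_forms" by (rule z_pow_normal_forms)
  then show ?thesis using u uc i by (simp add: z_pow_left_commute)
qed

lemma x_pow_normal_forms:
  "\<lbrakk>i < m; v \<in> normal_forms\<rbrakk> \<Longrightarrow> x i [^] (n::nat) \<otimes> v \<in> normal_forms"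
proof (induction n arbitrary: v)
  case (Suc n)
  then show ?case using normal_forms_carrier[OF Suc.prems(2)] x_normal_forms[of i v]
    by (simp add: m_assoc)
qed (simp add: normal_forms_carrier)

lemma normal_forms_eq_carrier: "normal_forms = carrier G"
proof
  show "carrier G \<subseteq> normal_forms"
  proof
    fix t assume t: "t \<in> carrier G"
    then have "t \<in> generate G (x ` {..<m})" by (simp add: generate_x)
    \<comment> \<open>In this form the product case of \<open>generate\<close> composes; the claim
      is read off at \<open>v = \<one>\<close>.\<close>
    then have "\<forall>v\<in>normal_forms. t \<otimes> v \<in> normal_forms"
    proof (induction rule: generate.induct)
      case one
      then show ?case by (simp add: normal_forms_carrier)
    next
      case (incl h)
      then show ?case using x_normal_forms by auto
    next
      case (inv h)
      then obtain i where i: "i < m" "h = x i" by auto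
      have "x i [^] (a i - 1) \<otimes> x i = z"
        using i a_gt_1[of i] x_pow_a[of i] nat_pow_Suc[of "x i" "a i - 1"] by simp
      then have "inv (x i) = z [^] (-1::int) \<otimes> x i [^] (a i - 1)"
        using i by (intro inv_equality) (simp_all add: m_assoc int_pow_neg)
      then have "inv h \<otimes> v = z [^] (-1::int) \<otimes> (x i [^] (a i - 1) \<otimes> v)" if "v \<in> normal_forms" for v
        using i normal_forms_carrier[OF that] by (simp add: m_assoc)
      then show ?case using i x_pow_normal_forms z_pow_normal_forms by simp
    next
      case (eng t u)
      then have "t \<in> carrier G" "u \<in> carrier G" by (simp_all add: generate_x)
      then show ?case using eng by (simp add: m_assoc normal_forms_carrier)
    qed
    moreover have "z [^] (0::int) \<otimes> \<one> \<in> normal_forms" by (intro normal_formsI) simp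
    ultimately show "t \<in> normal_forms" using t by force
  qed
qed (use normal_forms_carrier in auto)

text \<open>A suitable \<open>z\<close>-multiple of an alternating word lies in some
  \<open>D i\<close>, hence between \<open>\<one>\<close> and \<open>z\<close>.\<close>

lemma z_pow_decomposition:
  assumes "u \<in> carrier G"
  obtains k :: int and d where "u = z [^] k \<otimes> d" "d \<in> M" "d \<preceq> z"
proof -
  obtain k :: int and w where w: "u = z [^] k \<otimes> w" "w = \<one> \<or> (\<exists>i. alternating i w)"
    using assms[folded normal_forms_eq_carrier] unfolding normal_forms_def by blast
  show thesis
  proof (cases "w = \<one>")
    case True
    then show ?thesis using that[of k w] w M_one z_in_M one_le_iff by simp
  next
    case False
    then obtain i l where i: "i < m" "w \<in> carrier G" "z [^] (l::int) \<otimes> w \<in> D i"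
      using w alternating_D by blast
    then have "z [^] l \<otimes> w \<in> M" "z [^] l \<otimes> w \<preceq> z"
      using g_le_z[of "Suc i"] M_upward g_in_M le_trans by (auto simp: D_def)
    moreover have "u = z [^] (k - l) \<otimes> (z [^] l \<otimes> w)"
      using i w by (simp add: z_pow_z_pow)
    ultimately show ?thesis using that by blast
  qed
qed

text \<open>In the decomposition \<open>u = z [^] k \<otimes> d\<close>, a nonnegative
  \<open>k\<close> puts \<open>u\<close> into \<open>M\<close>; a negative one gives
  \<open>u \<preceq> z [^] (k + 1) \<preceq> \<one>\<close>, because
  \<open>d \<preceq> z\<close>.\<close>

lemma M_total:
  assumes "u \<in> carrier G" shows "u \<in> M \<or> inv u \<in> M"
proof -
  obtain k :: int and d where d: "u = z [^] k \<otimes> d" "d \<in> M" "d \<preceq> z"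
    using z_pow_decomposition[OF assms] by blast
  show ?thesis
  proof (cases "k \<ge> 0")
    case True
    then show ?thesis using d by (auto intro: M_mult z_pow_in_M)
  next
    case False
    have "u \<preceq> z [^] k \<otimes> z" using d by (auto intro: le_mult_left)
    also have "\<dots> = z [^] (k + 1)" by (simp add: int_pow_mult)
    also have "\<dots> \<preceq> z [^] (k + 1) \<otimes> z [^] (- (k + 1))"
      using False by (intro le_mult_M z_pow_in_M) auto
    also have "\<dots> = \<one>" by (simp flip: int_pow_mult)
    finally show ?thesis using assms by (simp add: le_def)
  qed
qed

text \<open>The assumption on \<open>p\<close> says that \<open>g 0\<close> moves \<open>p\<close>
  to the right. No point is moved to the left by any \<open>x i\<close>, so \<open>g_Suc\<close>
  passes this on to all \<open>g i\<close>, and monotonicity passes it on to their products.\<close>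

lemma
  assumes h: "h \<in> hom G (order_auts :: (real \<Rightarrow> real) monoid)"
    and hz: "\<And>t. h z t = t + 1"
    and p: "p + real m - 1 < h (xprod [0..<m]) p"
  shows action_moves_g: "i \<le> m \<Longrightarrow> p < h (g i) p"
    and action_moves_M: "u \<in> M \<Longrightarrow> u = \<one> \<or> p < h u p"
proof -
  interpret h: group_hom G "order_auts :: (real \<Rightarrow> real) monoid" h
    by (intro group_hom.intro is_group group_order_auts group_hom_axioms.intro h)
  note h.hom_inv [simp del]
  have mono: "h u s < h u t" if "s < t" "u \<in> carrier G" for u s t
    using h.hom_closed[OF that(2)] that(1) by (simp add: strict_mono_def)
  have mult: "h (u \<otimes> v) t = h u (h v t)" if "u \<in> carrier G" "v \<in> carrier G" for u v t
    using h.hom_mult[OF that] by simp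
  have one: "h \<one> t = t" for t using h.hom_one by simp
  have z_nat: "h (z [^] n) t = t + n" for n :: nat and t
    by (induction n arbitrary: t) (simp_all add: one mult hz)
  have z_pow: "h (z [^] k) t = t + k" for k :: int and t
  proof (cases "k < 0")
    case True
    have "h (inv (z [^] n)) s = s - n" for n :: nat and s
    proof -
      have "h (inv (z [^] n) \<otimes> z [^] n) (s - n) = h (inv (z [^] n)) (h (z [^] n) (s - n))"
        by (rule mult) auto
      then show ?thesis unfolding z_nat l_inv[OF nat_pow_closed[OF z_closed]] one by simp
    qed
    from this[of "nat (- k)" t] show ?thesis using True unfolding int_pow_def2 by simp
  next
    case False
    then show ?thesis using z_nat[of "nat k" t] unfolding int_pow_def2 by simp
  qed
  have x_pow_ge: "t \<le> h (x i [^] n) t" if i: "i < m" for i t and n :: nat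
  proof -
    \<comment> \<open>A point not moved to the right by \<open>x i\<close> would not be moved to the
      right by any power, but the power \<open>a i\<close> is the unit translation.\<close>
    have gt: "t < h (x i) t" for t
    proof (rule ccontr)
      assume le: "\<not> t < h (x i) t"
      have "h (x i [^] n) t \<le> t" for n :: nat
      proof (induction n)
        case (Suc n)
        have "h (x i [^] Suc n) t = h (x i [^] n) (h (x i) t)" using i by (simp add: mult)
        also have "\<dots> \<le> h (x i [^] n) t"
          using mono[of "h (x i) t" t "x i [^] n"] le i by (cases "h (x i) t = t") auto
        finally show ?case using Suc by simp
      qed (simp add: one)
      from this[of "a i"] show False using hz[of t] x_pow_a[OF i] by simp
    qed
    show ?thesis
    proof (induction n)
      case (Suc n)
      have "h (x i [^] n) t < h (x i [^] n) (h (x i) t)" using gt i by (intro mono) auto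
      also have "\<dots> = h (x i [^] Suc n) t" using i by (simp add: mult)
      finally show ?case using Suc by simp
    qed (simp add: one)
  qed
  show g: "p < h (g i) p" if "i \<le> m" for i
    using that
  proof (induction i)
    case 0
    have "h (g 0) p = h (xprod [0..<m]) p + (1 - real m)"
      unfolding g_def by (subst mult) (simp_all add: z_pow subset_iff)
    then show ?case using p by simp
  next
    case (Suc i)
    then have "h (g (Suc i)) p = h (x i [^] (a i - 1)) (h (g i) p)" by (simp add: g_Suc mult)
    then show ?case using Suc x_pow_ge[of i "h (g i) p" "a i - 1"] by simp
  qed
  show "u = \<one> \<or> p < h u p" if "u \<in> M"
    using that
  proof (induction rule: M.induct)
    case (M_step i u)
    then have "h (g i) p \<le> h (g i) (h u p)"
      using mono[of p "h u p" "g i"] one by auto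
    then show ?case using g[of i] M_step by (simp add: mult)
  qed simp
qed

end

text \<open>These facts make \<open>M\<close> without \<open>\<one>\<close> a positive cone. They do
  not follow from the relations alone, which also hold in the trivial group, and are obtained from
  an action on the line.\<close>

locale equal_powers_cone = equal_powers +
  assumes g_neq_one: "i < m \<Longrightarrow> g i \<noteq> \<one>"
    and M_antisym: "\<lbrakk>u \<in> M; inv u \<in> M\<rbrakk> \<Longrightarrow> u = \<one>"

text \<open>If a nontrivial \<open>u\<close> and its inverse were both in \<open>M\<close>, each
  would move \<open>p\<close> to the right, although their composite fixes it.\<close>

lemma (in equal_powers) equal_powers_cone_of_action:
  assumes h: "h \<in> hom G (order_auts :: (real \<Rightarrow> real) monoid)"
    and hz: "\<And>t. h z t = t + 1"
    and p: "p + real m - 1 < h (xprod [0..<m]) p"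
  shows "equal_powers_cone G x a m z"
proof
  interpret h: group_hom G "order_auts :: (real \<Rightarrow> real) monoid" h
    by (intro group_hom.intro is_group group_order_auts group_hom_axioms.intro h)
  note h.hom_inv [simp del]
  show "g i \<noteq> \<one>" if "i < m" for i
    using action_moves_g[OF assms, of i] that h.hom_one by auto
  show "u = \<one>" if u: "u \<in> M" "inv u \<in> M" for u
  proof (rule ccontr)
    assume "u \<noteq> \<one>"
    then have "p < h u p" "p < h (inv u) p"
      using u action_moves_M[OF assms] inv_eq_1_iff M_closed by blast+
    moreover have "h (inv u) (h u p) = p"
      using h.hom_mult[of "inv u" u] h.hom_one u by (simp add: fun_eq_iff)
    moreover have "strict_mono (h (inv u))"
      using h.hom_closed[of "inv u"] u by simp
    ultimately show False by (metis less_asym strict_mono_less)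
  qed
qed

section \<open>The ordering with positive cone \<open>M\<close> and its uniqueness\<close>

context equal_powers_cone
begin

lemma z_neq_one: "z \<noteq> \<one>"
proof
  assume z: "z = \<one>"
  have "inv (g 0) \<otimes> z \<in> M" using g_le_z[of 0] by (simp add: le_def)
  moreover have "inv (g 0) \<otimes> z = inv (g 0)" using z by (metis r_one inv_closed g_closed)
  ultimately have "inv (g 0) \<in> M" by simp
  then show False using M_antisym g_in_M g_neq_one m_pos by blast
qed

lemma z_pow_in_M_iff: "z [^] (k::int) \<in> M \<longleftrightarrow> 0 \<le> k"
proof
  assume k: "z [^] k \<in> M"
  show "0 \<le> k"
  proof (rule ccontr)
    assume "\<not> 0 \<le> k"
    \<comment> \<open>The exponent \<open>- k - 1\<close> is nonnegative and leaves exactly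
      \<open>inv z\<close>.\<close>
    then have "z [^] k \<otimes> z [^] (- k - 1) \<in> M" by (intro M_mult[OF k] z_pow_in_M) simp
    moreover have "z [^] k \<otimes> z [^] (- k - 1) = inv z"
      using int_pow_neg[of z 1] by (simp flip: int_pow_mult)
    ultimately have "inv z \<in> M" by simp
    then show False using M_antisym[OF z_in_M] z_neq_one by blast
  qed
qed (rule z_pow_in_M)

lemma le_antisym: "\<lbrakk>u \<preceq> v; v \<preceq> u\<rbrakk> \<Longrightarrow> u = v"
proof -
  assume *: "u \<preceq> v" "v \<preceq> u"
  then have "inv (inv u \<otimes> v) \<in> M" by (simp add: le_def inv_mult_group)
  then have "inv u \<otimes> v = \<one>" using * by (intro M_antisym) (auto simp: le_def)
  then have "u \<otimes> (inv u \<otimes> v) = u" using * by (simp add: le_def)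
  then show ?thesis using * by (simp add: le_def)
qed

definition cone_order :: "'a rel"
  where "cone_order = {(u, v). u \<preceq> v \<and> u \<noteq> v}"

lemma cone_order_left_ordering: "cone_order \<in> left_orderings G"
proof -
  have "trans cone_order"
    unfolding cone_order_def by (rule transI) (use le_trans le_antisym in blast)
  moreover have "irrefl cone_order" by (simp add: cone_order_def irrefl_def)
  moreover have "total_on (carrier G) cone_order"
  proof (rule total_onI)
    fix u v assume uv: "u \<in> carrier G" "v \<in> carrier G" "u \<noteq> v"
    then have "inv u \<otimes> v \<in> M \<or> inv v \<otimes> u \<in> M"
      using M_total[of "inv u \<otimes> v"] by (simp add: inv_mult_group)
    then show "(u, v) \<in> cone_order \<or> (v, u) \<in> cone_order" using uv by (auto simp: cone_order_def le_def)
  qed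
  moreover have "(h \<otimes> u, h \<otimes> v) \<in> cone_order"
    if "u \<in> carrier G" "v \<in> carrier G" "h \<in> carrier G" "(u, v) \<in> cone_order" for u v h
    using that by (simp add: cone_order_def le_mult_left)
  ultimately show ?thesis
    by (auto simp: left_orderings_def strict_linear_order_on_def cone_order_def dest: le_carrier)
qed

lemma one_cone_order_iff: "(\<one>, u) \<in> cone_order \<longleftrightarrow> u \<in> M \<and> u \<noteq> \<one>"
  by (auto simp: cone_order_def one_le_iff)

text \<open>Positivity of the generators forces positivity of all of \<open>M\<close> except
  \<open>\<one>\<close>, so \<open>s\<close> contains \<open>cone_order\<close>; a total strict
  ordering has no proper extension to a strict ordering. Hence finitely many conditions single out
  \<open>cone_order\<close>.\<close>

lemma cone_order_unique:
  assumes s: "s \<in> left_orderings G" and g: "\<And>i. i < m \<Longrightarrow> (\<one>, g i) \<in> s"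
  shows "s = cone_order"
proof -
  have tr: "trans s" and ir: "irrefl s" and sub: "s \<subseteq> carrier G \<times> carrier G"
    and inv: "\<And>u v h. \<lbrakk>u \<in> carrier G; v \<in> carrier G; h \<in> carrier G; (u, v) \<in> s\<rbrakk> \<Longrightarrow> (h \<otimes> u, h \<otimes> v) \<in> s"
    using s by (auto simp: left_orderings_def strict_linear_order_on_def)
  have M: "u = \<one> \<or> (\<one>, u) \<in> s" if "u \<in> M" for u
    using that
  proof (induction rule: M.induct)
    case (M_step i u)
    have "(\<one>, g i \<otimes> u) \<in> s" if "(\<one>, u) \<in> s"
    proof -
      have "(g i, g i \<otimes> u) \<in> s" using inv[of \<one> u "g i"] that M_step by simp
      then show ?thesis using g M_step tr by (blast dest: transD)
    qed
    then show ?case using M_step g by auto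
  qed simp
  have incl: "cone_order \<subseteq> s"
  proof clarify
    fix u v assume uv: "(u, v) \<in> cone_order"
    then have c: "u \<in> carrier G" "v \<in> carrier G" "inv u \<otimes> v \<in> M" "u \<noteq> v"
      by (auto simp: cone_order_def le_def)
    have "inv u \<otimes> v \<noteq> \<one>" using c inv_mult_cancel_left(2)[of u v] by (metis r_one)
    then have "(u \<otimes> \<one>, u \<otimes> (inv u \<otimes> v)) \<in> s" using M[OF c(3)] c by (intro inv) auto
    then show "(u, v) \<in> s" using c by simp
  qed
  have "s \<subseteq> cone_order"
  proof clarify
    fix u v assume uv: "(u, v) \<in> s"
    then have "u \<in> carrier G" "v \<in> carrier G" "u \<noteq> v" using sub ir by (auto simp: irrefl_def)
    then have "(u, v) \<in> cone_order \<or> (v, u) \<in> cone_order"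
      using cone_order_left_ordering
      by (auto simp: left_orderings_def strict_linear_order_on_def total_on_def)
    then show "(u, v) \<in> cone_order" using incl uv tr ir by (blast dest: transD irreflD)
  qed
  with incl show ?thesis by blast
qed

end

section \<open>Conjugates of least positive elements\<close>

fun ascents :: "nat list \<Rightarrow> nat" where
  "ascents (i # j # l) = (if i < j then 1 else 0) + ascents (j # l)"
| "ascents _ = 0"

lemma ascents_le: "ascents l \<le> length l - 1"
  by (induction l rule: ascents.induct) auto

lemma sorted_if_ascents_eq: "ascents l = length l - 1 \<Longrightarrow> sorted_wrt (<) l"
proof (induction l rule: ascents.induct)
  case (1 i j l)
  have "ascents (j # l) \<le> length l" using ascents_le[of "j # l"] by simp
  then have "i < j" "ascents (j # l) = length l" using 1(2) by (auto split: if_splits)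
  then show ?case using 1(1) by (simp add: sorted_wrt2 del: sorted_wrt.simps(2))
qed auto

lemma ascents_snoc: "l \<noteq> [] \<Longrightarrow> ascents (l @ [j]) = ascents l + (if last l < j then 1 else 0)"
  by (induction l rule: ascents.induct) auto

lemma distinct_imp_successively_neq: "distinct l \<Longrightarrow> successively (\<noteq>) l" for l :: "nat list"
  by (induction l rule: ascents.induct) auto

section \<open>Ascents and growth of powers\<close>

context equal_powers
begin

text \<open>Letters act from the right, starting on \<open>D j\<close>, so the appended
  \<open>j\<close> is the index with which the last letter of \<open>l\<close> is compared. An
  ascent costs one \<open>z\<close> by \<open>D_ascent\<close>, a descent none by
  \<open>D_descent\<close>.\<close>

lemma xprod_D:
  assumes "j < m" "u \<in> D j" "set l \<subseteq> {..<m}" "successively (\<noteq>) (l @ [j])"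
  shows "z [^] (- int (ascents (l @ [j]))) \<otimes> (xprod l \<otimes> u) \<in> D (hd (l @ [j]))"
  using assms(3,4)
proof (induction l)
  case Nil
  then show ?case using assms D_dest(3)[OF assms(2)] by simp
next
  case (Cons i l)
  define k where "k = hd (l @ [j])"
  have k: "k < m" "i \<noteq> k" and i: "i < m" and l: "set l \<subseteq> {..<m}" "successively (\<noteq>) (l @ [j])"
    using Cons.prems assms(1) by (cases l; simp add: k_def)+
  obtain l' where l': "l @ [j] = k # l'" by (cases "l @ [j]") (auto simp: k_def)
  define v where "v = z [^] (- int (ascents (l @ [j]))) \<otimes> (xprod l \<otimes> u)"
  have v: "v \<in> D k" using Cons.IH[OF l] by (simp add: v_def k_def)
  have u: "u \<in> carrier G" using assms(2) by (rule D_dest)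
  have xv: "x i [^] (1::nat) \<otimes> v = z [^] (- int (ascents (l @ [j]))) \<otimes> (xprod (i # l) \<otimes> u)"
    using i l u by (simp add: v_def z_pow_left_commute m_assoc)
  have c: "xprod (i # l) \<otimes> u \<in> carrier G" using i l u by simp
  show ?case
  proof (cases "i < k")
    case True
    then have "ascents ((i # l) @ [j]) = Suc (ascents (l @ [j]))" by (simp add: l')
    then show ?thesis using D_ascent[OF True k(1) v, of 1] a_gt_1[OF i]
      unfolding xv z_pow_z_pow[OF c] by simp
  next
    case False
    then have "ascents ((i # l) @ [j]) = ascents (l @ [j])" by (simp add: l')
    then show ?thesis using D_descent[OF _ i v, of 1] False k a_gt_1[OF i] unfolding xv by simp
  qed
qed

end

context equal_powers_cone
begin

text \<open>Each factor \<open>W\<close> gains at most \<open>c \<le> m - 2\<close> powers of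
  \<open>z\<close>, while \<open>z [^] (1 - int m)\<close> loses \<open>m - 1\<close>. If the
  conjugate \<open>v\<close> were in \<open>M\<close>, then
  \<open>f \<preceq> f \<otimes> v [^] n\<close> would lie below powers of \<open>z\<close> whose
  exponents tend to minus infinity with \<open>n\<close>.\<close>

lemma conjugate_not_in_M:
  assumes m: "1 < m" and \<pi>: "set \<pi> = {..<m}" "distinct \<pi>" "last \<pi> = m - 1" "\<pi> \<noteq> [0..<m]"
    and f: "f \<in> carrier G"
  shows "inv f \<otimes> (z [^] (1 - int m) \<otimes> xprod \<pi> \<otimes> f) \<notin> M"
proof
  define W where "W = xprod \<pi>"
  define v where "v = inv f \<otimes> (z [^] (1 - int m) \<otimes> W \<otimes> f)"
  assume "inv f \<otimes> (z [^] (1 - int m) \<otimes> xprod \<pi> \<otimes> f) \<in> M"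
  then have vM: "v \<in> M" by (simp add: v_def W_def)
  have W: "W \<in> carrier G" using \<pi> by (simp add: W_def)
  have len: "length \<pi> = m" using \<pi> distinct_card by fastforce
  then have ne: "\<pi> \<noteq> []" using m by auto
  define j where "j = hd \<pi>"
  have j: "j < m" using ne \<pi> hd_in_set by (auto simp: j_def)
  have "j \<noteq> last \<pi>"
  proof -
    have "\<pi> ! 0 \<noteq> \<pi> ! (m - 1)" using \<pi> len m by (subst nth_eq_iff_index_eq) auto
    then show ?thesis using ne len by (simp add: j_def hd_conv_nth last_conv_nth)
  qed
  \<comment> \<open>Repeating the first letter after \<open>\<pi>\<close> closes up the word, so
    that copies of \<open>W\<close> can be concatenated.\<close>
  then have succ: "successively (\<noteq>) (\<pi> @ [j])"
    using distinct_imp_successively_neq[OF \<pi>(2)] ne by (auto simp: successively_append_iff)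
  define c where "c = ascents (\<pi> @ [j])"
  have "ascents \<pi> \<noteq> m - 1"
  proof
    assume "ascents \<pi> = m - 1"
    then have "sorted_wrt (<) \<pi>" using len by (intro sorted_if_ascents_eq) simp
    then have "\<pi> = [0..<m]"
      using strict_sorted_equal[of "[0..<m]" \<pi>] \<pi>(1) by (simp add: atLeast0LessThan)
    then show False using \<pi> by simp
  qed
  then have "ascents \<pi> < m - 1" using ascents_le[of \<pi>] len by simp
  \<comment> \<open>The closing step adds no ascent, since \<open>last \<pi> = m - 1\<close> is the
    largest index.\<close>
  moreover have "\<not> last \<pi> < j" using \<pi> j by simp
  ultimately have c: "c + 2 \<le> m" using ne by (simp add: c_def ascents_snoc)

  have WD: "z [^] (- int c) \<otimes> (W \<otimes> u) \<in> D j" if "u \<in> D j" for u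
    using xprod_D[OF j that _ succ] \<pi> ne by (simp add: c_def W_def j_def)
  \<comment> \<open>The trailing \<open>x j\<close> is the starting point of the iteration inside
    \<open>D j\<close>; below, \<open>f\<close> is split as \<open>x j\<close> times
    \<open>inv (x j) \<otimes> f\<close> to match it.\<close>
  have WnD: "z [^] (- int (n * c)) \<otimes> (W [^] n \<otimes> x j) \<in> D j" for n
  proof (induction n)
    case 0
    then show ?case using x_pow_in_D[OF j, of 1] a_gt_1[OF j] j by simp
  next
    case (Suc n)
    define y where "y = W [^] n \<otimes> x j"
    have y: "y \<in> carrier G" using W j by (simp add: y_def)
    have "W [^] Suc n \<otimes> x j = W \<otimes> y"
      unfolding nat_pow_Suc2[OF W] y_def using W j by (simp add: m_assoc)
    moreover have "z [^] (- int c) \<otimes> (W \<otimes> (z [^] (- int (n * c)) \<otimes> y)) =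
      z [^] (- int c + - int (n * c)) \<otimes> (W \<otimes> y)"
      by (simp only: z_pow_left_commute[OF W y] z_pow_z_pow[OF m_closed[OF W y]])
    moreover have "- int c + - int (n * c) = - int (Suc n * c)" by simp
    ultimately show ?case using WD[OF Suc[folded y_def]] by metis
  qed
  have fv: "f \<otimes> v [^] n = z [^] ((1 - int m) * int n) \<otimes> (W [^] n \<otimes> f)" for n
  proof (induction n)
    case (Suc n)
    have v: "v \<in> carrier G" using vM by simp
    have "f \<otimes> v [^] Suc n = f \<otimes> v [^] n \<otimes> v" using f v by (simp add: m_assoc)
    also have "\<dots> = z [^] ((1 - int m) * int n) \<otimes> (W [^] n \<otimes> (f \<otimes> v))"
      unfolding Suc using f v W by (simp add: m_assoc)
    also have "f \<otimes> v = z [^] (1 - int m) \<otimes> (W \<otimes> f)" using f W by (simp add: v_def m_assoc)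
    also have "W [^] n \<otimes> (z [^] (1 - int m) \<otimes> (W \<otimes> f)) = z [^] (1 - int m) \<otimes> (W [^] n \<otimes> (W \<otimes> f))"
      using f W by (intro z_pow_left_commute) auto
    also have "W [^] n \<otimes> (W \<otimes> f) = W [^] Suc n \<otimes> f" using f W by (simp add: m_assoc)
    also have "z [^] ((1 - int m) * int n) \<otimes> (z [^] (1 - int m) \<otimes> (W [^] Suc n \<otimes> f)) =
      z [^] ((1 - int m) * int n + (1 - int m)) \<otimes> (W [^] Suc n \<otimes> f)"
      using f W by (intro z_pow_z_pow) auto
    also have "(1 - int m) * int n + (1 - int m) = (1 - int m) * int (Suc n)" by (simp add: algebra_simps)
    finally show ?case .
  qed (use f in simp)

  obtain \<alpha> :: int and e where e: "inv (x j) \<otimes> f = z [^] \<alpha> \<otimes> e" "e \<in> M" "e \<preceq> z"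
    using z_pow_decomposition[of "inv (x j) \<otimes> f"] f j by auto
  obtain \<beta> :: int and d where d: "f = z [^] \<beta> \<otimes> d" "d \<in> M"
    using z_pow_decomposition[OF f] by metis
  \<comment> \<open>The constant \<open>2\<close> pays for \<open>w \<preceq> z\<close> and for
    \<open>e \<preceq> z\<close>.\<close>
  have upper: "W [^] n \<otimes> f \<preceq> z [^] (int (n * c) + \<alpha> + 2)" for n
  proof -
    define w where "w = z [^] (- int (n * c)) \<otimes> (W [^] n \<otimes> x j)"
    have w: "w \<preceq> z" "w \<in> carrier G"
      using WnD[of n] D_dest g_le_z[of "Suc j"] j le_trans unfolding w_def by (meson Suc_leI)+
    have "W [^] n \<otimes> f = W [^] n \<otimes> (x j \<otimes> (inv (x j) \<otimes> f))" using f j by simp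
    also have "\<dots> = (W [^] n \<otimes> x j) \<otimes> (z [^] \<alpha> \<otimes> e)" using f j W e by (simp add: m_assoc)
    also have "W [^] n \<otimes> x j = z [^] int (n * c) \<otimes> w"
      using j W by (simp add: w_def z_pow_z_pow)
    also have "z [^] int (n * c) \<otimes> w \<otimes> (z [^] \<alpha> \<otimes> e) = z [^] (int (n * c) + \<alpha>) \<otimes> (w \<otimes> e)"
      using w M_closed[OF e(2)]
      by (simp only: m_assoc z_pow_left_commute[OF w(2) M_closed[OF e(2)]] z_pow_z_pow int_pow_closed
          z_closed m_closed)
    also have "\<dots> \<preceq> z [^] (int (n * c) + \<alpha>) \<otimes> (w \<otimes> z)"
      using w e by (intro le_mult_left) auto
    also have "\<dots> = z [^] (int (n * c) + \<alpha>) \<otimes> (z \<otimes> w)" using w by (simp add: z_commute)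
    also have "\<dots> \<preceq> z [^] (int (n * c) + \<alpha>) \<otimes> (z \<otimes> z)"
      using w by (intro le_mult_left) auto
    also have "z \<otimes> z = z [^] (2::int)" using int_pow_mult[of z 1 1] by simp
    finally show ?thesis by (simp flip: int_pow_mult)
  qed
  \<comment> \<open>The upper exponent drops by at least one per step, so this \<open>n\<close>
    pushes it below \<open>\<beta>\<close>.\<close>
  define n where "n = nat (\<alpha> + 3 - \<beta>)"
  define E where "E = (1 - int m) * int n + (int (n * c) + \<alpha> + 2)"
  have "z [^] \<beta> \<preceq> f" using d le_mult_M by simp
  also have "f \<preceq> f \<otimes> v [^] n" using f vM by (intro le_mult_M M_pow) auto
  also have "\<dots> \<preceq> z [^] ((1 - int m) * int n) \<otimes> z [^] (int (n * c) + \<alpha> + 2)"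
    unfolding fv by (intro le_mult_left upper) simp
  also have "\<dots> = z [^] E" by (simp add: E_def flip: int_pow_mult)
  finally have "inv (z [^] \<beta>) \<otimes> z [^] E \<in> M" by (simp add: le_def)
  then have "z [^] (E - \<beta>) \<in> M"
    using int_pow_mult[of z "- \<beta>" E] by (simp add: int_pow_neg)
  then have "0 \<le> - \<beta> + \<alpha> + 2 + int n * (1 - int m + int c)"
    by (simp add: z_pow_in_M_iff E_def algebra_simps)
  moreover have "int n * (1 - int m + int c) \<le> int n * (- 1)"
    using c by (intro mult_left_mono) auto
  moreover have "\<alpha> + 3 - \<beta> \<le> int n" by (simp add: n_def)
  ultimately show False by linarith
qed

end

section \<open>Isolated orderings\<close>

text \<open>A sufficient criterion for being isolated whose witness \<open>F\<close> can be
  transported explicitly under translation and reversal.\<close>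

definition finitely_determined :: "('a, 'b) monoid_scheme \<Rightarrow> 'a rel \<Rightarrow> bool"
  where "finitely_determined G r \<longleftrightarrow> r \<in> left_orderings G \<and>
    (\<exists>F. finite F \<and> F \<subseteq> carrier G \<and>
      (\<forall>s\<in>left_orderings G. (\<forall>g\<in>F. (\<one>\<^bsub>G\<^esub>, g) \<in> s) \<longleftrightarrow> s = r))"

lemma finitely_determined_isolated:
  assumes "finitely_determined G r" shows "r \<in> isolated_orderings G"
proof -
  obtain F where F: "finite F" "F \<subseteq> carrier G"
    "\<And>s. s \<in> left_orderings G \<Longrightarrow> (\<forall>g\<in>F. (\<one>\<^bsub>G\<^esub>, g) \<in> s) \<longleftrightarrow> s = r"
    and r: "r \<in> left_orderings G"
    using assms by (auto simp: finitely_determined_def)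
  define U where "U g = {s \<in> left_orderings G. (\<one>\<^bsub>G\<^esub>, g) \<in> s}" for g
  have U: "openin (LO G) (U g)" if "g \<in> F" for g
    unfolding LO_def U_def using that F by (intro topology_generated_by_Basis) auto
  \<comment> \<open>Intersecting with the whole space covers an empty \<open>F\<close>, for which
    the indexed intersection is \<open>UNIV\<close>.\<close>
  have "{r} = topspace (LO G) \<inter> (\<Inter>g\<in>F. U g)"
    using F(3) r by (auto simp: U_def topspace_LO)
  moreover have "openin (LO G) (topspace (LO G) \<inter> (\<Inter>g\<in>F. U g))"
  proof (cases "F = {}")
    case False
    then show ?thesis using F U by (intro openin_Int openin_INT) auto
  qed simp
  ultimately show ?thesis using r by (simp add: isolated_orderings_def topspace_LO)
qed

section \<open>Translates and opposites of orderings\<close>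

context group
begin

lemma left_orderings_mult_iff:
  assumes "r \<in> left_orderings G" "u \<in> carrier G" "v \<in> carrier G" "h \<in> carrier G"
  shows "(h \<otimes> u, h \<otimes> v) \<in> r \<longleftrightarrow> (u, v) \<in> r"
proof -
  have inv: "\<And>u v h. \<lbrakk>u \<in> carrier G; v \<in> carrier G; h \<in> carrier G; (u, v) \<in> r\<rbrakk> \<Longrightarrow> (h \<otimes> u, h \<otimes> v) \<in> r"
    using assms(1) by (auto simp: left_orderings_def)
  have "inv h \<otimes> (h \<otimes> w) = w" if "w \<in> carrier G" for w
    using that assms(4) by (simp add: m_assoc[symmetric])
  then show ?thesis using inv[of "h \<otimes> u" "h \<otimes> v" "inv h"] inv[of u v h] assms by auto
qed

text \<open>Translation conjugates the positive cone: \<open>\<one>\<close> and \<open>u\<close> are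
  compared as \<open>f\<close> and \<open>u \<otimes> f\<close>, and left invariance cancels
  \<open>f\<close>.\<close>

lemma one_LO_translate_iff:
  assumes "r \<in> left_orderings G" "f \<in> carrier G" "u \<in> carrier G"
  shows "(\<one>, u) \<in> LO_translate G f r \<longleftrightarrow> (\<one>, inv f \<otimes> (u \<otimes> f)) \<in> r"
proof -
  have "(\<one>, u) \<in> LO_translate G f r \<longleftrightarrow> (f, u \<otimes> f) \<in> r"
    using assms by (simp add: LO_translate_def)
  also have "\<dots> \<longleftrightarrow> (inv f \<otimes> f, inv f \<otimes> (u \<otimes> f)) \<in> r"
    using assms by (subst left_orderings_mult_iff) auto
  finally show ?thesis using assms by simp
qed

text \<open>The conjugates of \<open>F\<close> by \<open>f\<close> test for the translate:
  translating \<open>s\<close> back by \<open>inv f\<close> reduces this to the test for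
  \<open>r\<close>.\<close>

lemma finitely_determined_LO_translate:
  assumes r: "finitely_determined G r" and f: "f \<in> carrier G"
  shows "finitely_determined G (LO_translate G f r)"
proof -
  interpret act: group_action G "left_orderings G" "LO_translate G"
    by (rule group_action_LO_translate)
  obtain F where F: "finite F" "F \<subseteq> carrier G"
    "\<And>s. s \<in> left_orderings G \<Longrightarrow> (\<forall>g\<in>F. (\<one>, g) \<in> s) \<longleftrightarrow> s = r"
    and rLO: "r \<in> left_orderings G"
    using r by (auto simp: finitely_determined_def)
  let ?F = "(\<lambda>g. f \<otimes> (g \<otimes> inv f)) ` F"
  have cancel: "LO_translate G f (LO_translate G (inv f) s) = s"
    "LO_translate G (inv f) (LO_translate G f s) = s" if "s \<in> left_orderings G" for s
    using act.composition_rule[OF that f inv_closed[OF f]] act.composition_rule[OF that inv_closed[OF f] f]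
      act.id_eq_one that f by (metis l_inv r_inv id_apply restrict_apply)+
  have "(\<forall>g\<in>?F. (\<one>, g) \<in> s) \<longleftrightarrow> s = LO_translate G f r" if s: "s \<in> left_orderings G" for s
  proof -
    have sLO: "LO_translate G (inv f) s \<in> left_orderings G"
      using act.element_image[of "inv f" s] s f by simp
    have "(\<forall>g\<in>?F. (\<one>, g) \<in> s) \<longleftrightarrow> (\<forall>g\<in>F. (\<one>, g) \<in> LO_translate G (inv f) s)"
      using one_LO_translate_iff[OF s inv_closed[OF f]] F(2) f by auto
    also have "\<dots> \<longleftrightarrow> LO_translate G (inv f) s = r" by (rule F(3)[OF sLO])
    also have "\<dots> \<longleftrightarrow> s = LO_translate G f r" using cancel s rLO by metis
    finally show ?thesis .
  qed
  moreover have "LO_translate G f r \<in> left_orderings G"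
    using act.element_image[of f r] f rLO by simp
  moreover have "?F \<subseteq> carrier G" using F(2) f by auto
  ultimately show ?thesis using F(1) unfolding finitely_determined_def by blast
qed

lemma left_orderings_converse: "r \<in> left_orderings G \<Longrightarrow> r\<inverse> \<in> left_orderings G"
  by (auto simp: left_orderings_def strict_linear_order_on_def irrefl_def)

lemma one_converse_iff:
  assumes "r \<in> left_orderings G" "u \<in> carrier G"
  shows "(\<one>, u) \<in> r\<inverse> \<longleftrightarrow> (\<one>, inv u) \<in> r"
  using left_orderings_mult_iff[of r u \<one> "inv u"] assms by simp

lemma finitely_determined_converse:
  assumes r: "finitely_determined G r" shows "finitely_determined G (r\<inverse>)"
proof -
  obtain F where F: "finite F" "F \<subseteq> carrier G"
    "\<And>s. s \<in> left_orderings G \<Longrightarrow> (\<forall>g\<in>F. (\<one>, g) \<in> s) \<longleftrightarrow> s = r"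
    and rLO: "r \<in> left_orderings G"
    using r by (auto simp: finitely_determined_def)
  have "(\<forall>g\<in>m_inv G ` F. (\<one>, g) \<in> s) \<longleftrightarrow> s = r\<inverse>" if s: "s \<in> left_orderings G" for s
  proof -
    have "(\<forall>g\<in>m_inv G ` F. (\<one>, g) \<in> s) \<longleftrightarrow> (\<forall>g\<in>F. (\<one>, g) \<in> s\<inverse>)"
      using one_converse_iff[OF s] F(2) by auto
    also have "\<dots> \<longleftrightarrow> s\<inverse> = r" by (rule F(3)[OF left_orderings_converse[OF s]])
    also have "\<dots> \<longleftrightarrow> s = r\<inverse>" by (metis converse_converse)
    finally show ?thesis .
  qed
  moreover have "m_inv G ` F \<subseteq> carrier G" using F(2) by auto
  ultimately show ?thesis
    using F(1) left_orderings_converse[OF rLO] unfolding finitely_determined_def by blast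
qed

lemma LO_translate_converse:
  "r \<in> left_orderings G \<Longrightarrow> LO_translate G f (r\<inverse>) = (LO_translate G f r)\<inverse>"
  by (auto simp: LO_translate_def left_orderings_converse)

lemma orbit_finitely_determined:
  assumes "finitely_determined G r"
  shows "orbit G (LO_translate G) r \<subseteq> isolated_orderings G"
  using finitely_determined_isolated[OF finitely_determined_LO_translate[OF assms]]
  by (auto simp: orbit_def)

end

lemma (in equal_powers_cone) one_less_z: "(\<one>, z) \<in> cone_order"
  and not_one_less_inv_z: "(\<one>, inv z) \<notin> cone_order"
  using z_in_M z_neq_one M_antisym by (auto simp: one_cone_order_iff)

lemma (in equal_powers_cone) finitely_determined_cone_order: "finitely_determined G cone_order"
proof -
  have "(\<forall>u\<in>g ` {..<m}. (\<one>, u) \<in> s) \<longleftrightarrow> s = cone_order" if "s \<in> left_orderings G" for s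
    using cone_order_unique[OF that] g_in_M g_neq_one one_cone_order_iff by auto
  then show ?thesis
    using cone_order_left_ordering unfolding finitely_determined_def
    by (intro conjI exI[of _ "g ` {..<m}"]) auto
qed

section \<open>The orderings attached to permutations\<close>

context
  fixes m :: nat and a :: "nat \<Rightarrow> nat"
  assumes m: "1 < m" and a: "\<And>i. i \<in> {1..m} \<Longrightarrow> 1 < a i"
begin

private abbreviation (input) G where "G \<equiv> equal_powers_group m a"
private abbreviation (input) Z where "Z \<equiv> equal_powers_gen m a 1 [^]\<^bsub>equal_powers_group m a\<^esub> a 1"
private abbreviation (input) X where "X \<sigma> \<equiv> (\<lambda>i. equal_powers_gen m a (\<sigma> ! i))"

text \<open>\<open>\<sigma>\<close> sends positions in \<open>{..<m}\<close> to generator indices in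
  \<open>{1..m}\<close>. Every choice of \<open>\<sigma>\<close> has the same central element
  \<open>Z\<close>, so the resulting orderings can be compared.\<close>

lemma equal_powers_of_permutation:
  assumes \<sigma>: "\<sigma> \<in> permutations_of_set {1..m}"
  shows "equal_powers G (X \<sigma>) (\<lambda>i. a (\<sigma> ! i)) m Z"
proof -
  interpret G: group G by (rule group_equal_powers_group)
  have len: "length \<sigma> = m" using length_finite_permutations_of_set[OF \<sigma>] by simp
  have set: "set \<sigma> = {1..m}" using \<sigma> by (simp add: permutations_of_set_def)
  have nth: "\<sigma> ! i \<in> {1..m}" if "i < m" for i
    using that len set by (metis nth_mem)
  have bij: "bij_betw ((!) \<sigma>) {..<m} {1..m}"
    using \<sigma> len set by (intro bij_betw_nth) (auto simp: permutations_of_set_def)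
  show ?thesis
  proof unfold_locales
    show "0 < m" using m by simp
    show "X \<sigma> i \<in> carrier G" "1 < a (\<sigma> ! i)" "X \<sigma> i [^]\<^bsub>G\<^esub> a (\<sigma> ! i) = Z" if "i < m" for i
      using nth[OF that] by (rule equal_powers_gen_closed a equal_powers_gen_pow)+
    have "X \<sigma> ` {..<m} = equal_powers_gen m a ` {1..m}"
      by (simp only: bij_betw_imp_surj_on[OF bij, symmetric] image_image)
    then show "generate G (X \<sigma> ` {..<m}) = carrier G" by (simp only: generate_equal_powers_gen)
  qed
qed

text \<open>Roots of the unit translation are chosen so that the generator at position
  \<open>i\<close> moves \<open>P (Suc i)\<close> to \<open>P i\<close>. Their product carries
  \<open>P m = 0\<close> to \<open>P 0 = m * s\<close>, beyond \<open>m - 1\<close>.\<close>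

lemma equal_powers_cone_of_permutation:
  assumes \<sigma>: "\<sigma> \<in> permutations_of_set {1..m}"
  shows "equal_powers_cone G (X \<sigma>) (\<lambda>i. a (\<sigma> ! i)) m Z"
proof -
  interpret equal_powers G "X \<sigma>" "\<lambda>i. a (\<sigma> ! i)" m Z
    by (rule equal_powers_of_permutation[OF \<sigma>])
  have len: "length \<sigma> = m" using length_finite_permutations_of_set[OF \<sigma>] by simp
  have set: "set \<sigma> = {1..m}" and dist: "distinct \<sigma>" using \<sigma> by (auto simp: permutations_of_set_def)
  \<comment> \<open>A root can move a chosen point by any amount strictly between \<open>0\<close>
    and \<open>1\<close>; with this amount \<open>m\<close> steps add up to
    \<open>m - 1 / 2\<close>.\<close>
  define s where "s = 1 - 1 / (2 * real m)"
  have s: "0 < s" "s < 1" using m by (auto simp: s_def field_simps)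
  define P where "P i = (real m - real i) * s" for i
  \<comment> \<open>The homomorphism is prescribed on generators, so \<open>pos\<close> recovers the
    position of a generator in \<open>\<sigma>\<close>.\<close>
  define pos where "pos = inv_into {..<m} ((!) \<sigma>)"
  have pos: "pos (\<sigma> ! i) = i" if "i < m" for i
    unfolding pos_def using that dist len by (intro inv_into_f_f) (auto simp: inj_on_def nth_eq_iff_index_eq)
  have "\<exists>f. strict_mono f \<and> surj f \<and> (\<forall>t. (f ^^ a j) t = t + 1) \<and> f (P (Suc (pos j))) = P (pos j)"
    if j: "j \<in> {1..m}" for j
  proof -
    have "P (pos j) = P (Suc (pos j)) + s" by (simp add: P_def algebra_simps)
    then show ?thesis using root_of_translation[OF a[OF j] s, of "P (Suc (pos j))"] by metis
  qed
  then obtain F where F: "\<And>j. j \<in> {1..m} \<Longrightarrow> strict_mono (F j) \<and> surj (F j) \<and>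
      (\<forall>t. (F j ^^ a j) t = t + 1) \<and> F j (P (Suc (pos j))) = P (pos j)"
    by metis
  have closed: "F \<in> {1..m} \<rightarrow> carrier order_auts" using F by auto
  have pow: "F i [^]\<^bsub>order_auts\<^esub> a i = (\<lambda>t. t + 1)" if "i \<in> {1..m}" for i
    using F[OF that] by (auto simp: order_auts_pow)
  obtain h where h: "h \<in> hom G order_auts" and h_gen: "\<And>i. i \<in> {1..m} \<Longrightarrow> h (equal_powers_gen m a i) = F i"
    using equal_powers_group_hom[OF group_order_auts closed pow] by metis
  interpret h: group_hom G "order_auts :: (real \<Rightarrow> real) monoid" h
    by (intro group_hom.intro is_group group_order_auts group_hom_axioms.intro h)
  have hZ: "h Z t = t + 1" for t
  proof -
    have "1 \<in> {1..m}" using m by simp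
    then have "h Z = (\<lambda>t. t + 1)"
      using h.hom_nat_pow[OF equal_powers_gen_closed, of 1 "a 1"] h_gen pow by simp
    then show ?thesis by simp
  qed
  have "h (xprod [i..<m]) 0 = P i" if "i \<le> m" for i
    using that
  proof (induction i rule: inc_induct)
    case base
    then show ?case using h.hom_one by (simp add: P_def)
  next
    case (step n)
    have n: "\<sigma> ! n \<in> {1..m}" using step len set by (metis nth_mem)
    have "xprod [Suc n..<m] \<in> carrier G" by (rule xprod_closed) auto
    then have "h (xprod [n..<m]) = h (X \<sigma> n) \<circ> h (xprod [Suc n..<m])"
      using step h.hom_mult[of "X \<sigma> n" "xprod [Suc n..<m]"] x_closed[of n]
      by (simp add: upt_conv_Cons)
    then show ?case using step F[OF n] pos[of n] h_gen[OF n] by simp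
  qed
  moreover have "real m * s = real m - 1 / 2" using m by (simp add: s_def field_simps)
  ultimately have "0 + real m - 1 < h (xprod [0..<m]) 0" using m by (simp add: P_def)
  then show ?thesis by (rule equal_powers_cone_of_action[OF h hZ])
qed

definition permutation_order where
  "permutation_order \<sigma> = equal_powers_cone.cone_order G (X \<sigma>) m Z"

lemma permutation_order_finitely_determined:
  "\<sigma> \<in> permutations_of_set {1..m} \<Longrightarrow> finitely_determined G (permutation_order \<sigma>)"
  unfolding permutation_order_def
  by (rule equal_powers_cone.finitely_determined_cone_order[OF equal_powers_cone_of_permutation])

lemma Z_positive:
  assumes \<sigma>: "\<sigma> \<in> permutations_of_set {1..m}"
  shows "(\<one>\<^bsub>G\<^esub>, Z) \<in> permutation_order \<sigma>" "(\<one>\<^bsub>G\<^esub>, inv\<^bsub>G\<^esub> Z) \<notin> permutation_order \<sigma>"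
proof -
  interpret equal_powers_cone G "X \<sigma>" "\<lambda>i. a (\<sigma> ! i)" m Z
    by (rule equal_powers_cone_of_permutation[OF \<sigma>])
  show "(\<one>\<^bsub>G\<^esub>, Z) \<in> permutation_order \<sigma>" "(\<one>\<^bsub>G\<^esub>, inv\<^bsub>G\<^esub> Z) \<notin> permutation_order \<sigma>"
    unfolding permutation_order_def by (fact one_less_z not_one_less_inv_z)+
qed

text \<open>In the labelling by \<open>\<tau>\<close>, the positive element \<open>S.g 0\<close> is
  a power of \<open>Z\<close> times the product along \<open>\<pi>\<close>, the list of positions in
  \<open>\<tau>\<close> of the entries of \<open>\<sigma>\<close>. The translation would put a
  conjugate of it into \<open>T.M\<close>, against \<open>conjugate_not_in_M\<close>.\<close>

lemma permutation_orders_not_conjugate: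
  assumes \<sigma>: "\<sigma> \<in> permutations_of_set {1..m}" "last \<sigma> = m"
    and \<tau>: "\<tau> \<in> permutations_of_set {1..m}" "last \<tau> = m"
    and f: "f \<in> carrier G" and eq: "permutation_order \<sigma> = LO_translate G f (permutation_order \<tau>)"
  shows "\<sigma> = \<tau>"
proof (rule ccontr)
  assume "\<sigma> \<noteq> \<tau>"
  interpret S: equal_powers_cone G "X \<sigma>" "\<lambda>i. a (\<sigma> ! i)" m Z
    by (rule equal_powers_cone_of_permutation[OF \<sigma>(1)])
  interpret T: equal_powers_cone G "X \<tau>" "\<lambda>i. a (\<tau> ! i)" m Z
    by (rule equal_powers_cone_of_permutation[OF \<tau>(1)])
  have len: "length \<sigma> = m" "length \<tau> = m"
    using length_finite_permutations_of_set[OF \<sigma>(1)] length_finite_permutations_of_set[OF \<tau>(1)] by simp_all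
  have set: "set \<sigma> = {1..m}" "set \<tau> = {1..m}" and dist: "distinct \<sigma>" "distinct \<tau>"
    using \<sigma> \<tau> by (auto simp: permutations_of_set_def)
  have bij: "bij_betw ((!) \<tau>) {..<m} {1..m}"
    using bij_betw_nth[OF dist(2)] len set by simp
  define pos where "pos = inv_into {..<m} ((!) \<tau>)"
  define \<pi> where "\<pi> = map pos \<sigma>"
  have bij': "bij_betw pos {1..m} {..<m}" unfolding pos_def by (rule bij_betw_inv_into[OF bij])
  have nth_pos: "\<tau> ! pos j = j" if "j \<in> {1..m}" for j
    using bij_betw_inv_into_right[OF bij that] by (simp add: pos_def)
  have pos_nth: "pos (\<tau> ! i) = i" if "i < m" for i
    using bij_betw_inv_into_left[OF bij, of i] that by (simp add: pos_def)
  have map_pi: "map ((!) \<tau>) \<pi> = \<sigma>"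
    unfolding \<pi>_def using nth_pos set by (auto intro!: map_idI)
  have "set \<pi> = {..<m}" using bij' set by (simp add: \<pi>_def bij_betw_def)
  moreover have "distinct \<pi>"
    using bij' set dist by (simp add: \<pi>_def distinct_map bij_betw_def)
  moreover have "last \<pi> = m - 1"
  proof -
    have "\<sigma> \<noteq> []" "\<tau> \<noteq> []" using len m by auto
    then have "last \<pi> = pos (\<tau> ! (m - 1))" using \<sigma>(2) \<tau>(2) len by (simp add: \<pi>_def last_map last_conv_nth[of \<tau>])
    then show ?thesis using pos_nth m by simp
  qed
  moreover have "\<pi> \<noteq> [0..<m]"
  proof
    assume "\<pi> = [0..<m]"
    then have "\<sigma> = map ((!) \<tau>) [0..<length \<tau>]" using map_pi len by simp
    then show False using \<open>\<sigma> \<noteq> \<tau>\<close> by (simp add: map_nth)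
  qed
  ultimately have "inv\<^bsub>G\<^esub> f \<otimes>\<^bsub>G\<^esub> (Z [^]\<^bsub>G\<^esub> (1 - int m) \<otimes>\<^bsub>G\<^esub> T.xprod \<pi> \<otimes>\<^bsub>G\<^esub> f) \<notin> T.M"
    by (rule T.conjugate_not_in_M[OF m _ _ _ _ f])
  moreover have "T.xprod \<pi> = S.xprod [0..<m]"
  proof -
    have T: "T.xprod \<pi> = foldr (\<otimes>\<^bsub>G\<^esub>) (map (equal_powers_gen m a) (map ((!) \<tau>) \<pi>)) \<one>\<^bsub>G\<^esub>"
      by (simp add: T.xprod_def foldr_map comp_def)
    have "S.xprod [0..<m] = foldr (\<otimes>\<^bsub>G\<^esub>) (map (equal_powers_gen m a) (map ((!) \<sigma>) [0..<length \<sigma>])) \<one>\<^bsub>G\<^esub>"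
      by (simp add: S.xprod_def foldr_map comp_def len)
    then show ?thesis unfolding T map_pi map_nth by simp
  qed
  moreover have "inv\<^bsub>G\<^esub> f \<otimes>\<^bsub>G\<^esub> (S.g 0 \<otimes>\<^bsub>G\<^esub> f) \<in> T.M"
  proof -
    have "(\<one>\<^bsub>G\<^esub>, S.g 0) \<in> permutation_order \<sigma>"
      unfolding permutation_order_def S.one_cone_order_iff using S.g_in_M S.g_neq_one S.m_pos by blast
    then have "(\<one>\<^bsub>G\<^esub>, S.g 0) \<in> LO_translate G f T.cone_order"
      unfolding eq unfolding permutation_order_def .
    then show ?thesis
      unfolding S.one_LO_translate_iff[OF T.cone_order_left_ordering f S.g_closed] T.one_cone_order_iff
      by blast
  qed
  ultimately show False by (simp add: S.g_def del: One_nat_def)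
qed

lemma orbits_of_permutation_orders:
  "\<exists>\<O> \<subseteq> orbits G (left_orderings G) (LO_translate G).
    finite \<O> \<and> card \<O> = 2 * fact (m - 1) \<and> (\<forall>C\<in>\<O>. C \<subseteq> isolated_orderings G)"
proof -
  interpret G: group G by (rule group_equal_powers_group)
  interpret act: group_action G "left_orderings G" "LO_translate G"
    by (rule G.group_action_LO_translate)
  \<comment> \<open>Fixing the last entry \<open>m\<close> meets the assumption of
    \<open>permutation_orders_not_conjugate\<close> and leaves \<open>fact (m - 1)\<close>
    permutations.\<close>
  define \<Sigma> where "\<Sigma> = (\<lambda>l. l @ [m]) ` permutations_of_set {1..m - 1}"
  have \<Sigma>: "\<sigma> \<in> permutations_of_set {1..m}" "last \<sigma> = m" if "\<sigma> \<in> \<Sigma>" for \<sigma>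
    using that m by (auto simp: \<Sigma>_def permutations_of_set_def)
  have card: "finite \<Sigma>" "card \<Sigma> = fact (m - 1)"
    unfolding \<Sigma>_def by (simp_all add: card_image inj_on_def)
  \<comment> \<open>The boolean chooses between an ordering and its opposite and accounts for the
    factor \<open>2\<close>.\<close>
  define ord where "ord = (\<lambda>(b, \<sigma>). if b then permutation_order \<sigma> else (permutation_order \<sigma>)\<inverse>)"
  have fd: "finitely_determined G (ord p)" if "p \<in> UNIV \<times> \<Sigma>" for p
    using that \<Sigma> permutation_order_finitely_determined G.finitely_determined_converse
    by (auto simp: ord_def)
  have LO: "ord p \<in> left_orderings G" if "p \<in> UNIV \<times> \<Sigma>" for p
    using fd[OF that] by (simp add: finitely_determined_def)
  have permLO: "permutation_order \<sigma> \<in> left_orderings G" if "\<sigma> \<in> \<Sigma>" for \<sigma>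
    using permutation_order_finitely_determined \<Sigma> that by (simp add: finitely_determined_def)
  have Z: "Z \<in> carrier G" using m by (intro G.nat_pow_closed equal_powers_gen_closed) simp
  have Z_sign: "(\<one>\<^bsub>G\<^esub>, Z) \<in> ord (b, \<sigma>) \<longleftrightarrow> b" if "\<sigma> \<in> \<Sigma>" for b \<sigma>
    using Z_positive \<Sigma>(1)[OF that] G.one_converse_iff[OF permLO[OF that] Z] by (simp add: ord_def)
  have inj: "inj_on (\<lambda>p. orbit G (LO_translate G) (ord p)) (UNIV \<times> \<Sigma>)"
  proof (rule inj_onI, clarify)
    fix b \<sigma> b' \<tau>
    assume \<sigma>: "\<sigma> \<in> \<Sigma>" and \<tau>: "\<tau> \<in> \<Sigma>"
      and "orbit G (LO_translate G) (ord (b, \<sigma>)) = orbit G (LO_translate G) (ord (b', \<tau>))"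
    then have "ord (b, \<sigma>) \<in> orbit G (LO_translate G) (ord (b', \<tau>))"
      using act.orbit_refl[OF LO[of "(b, \<sigma>)"]] by simp
    then obtain f where f: "f \<in> carrier G" and eq: "ord (b, \<sigma>) = LO_translate G f (ord (b', \<tau>))"
      by (auto simp: orbit_def)
    \<comment> \<open>\<open>Z\<close> is central, so translation preserves its sign, and the sign
      of \<open>Z\<close> is the boolean.\<close>
    have "inv\<^bsub>G\<^esub> f \<otimes>\<^bsub>G\<^esub> (Z \<otimes>\<^bsub>G\<^esub> f) = Z"
    proof -
      interpret equal_powers G "X \<tau>" "\<lambda>i. a (\<tau> ! i)" m Z
        by (rule equal_powers_of_permutation[OF \<Sigma>(1)[OF \<tau>]])
      show ?thesis using f Z z_commute[OF f] by simp
    qed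
    then have b: "b = b'"
      using Z_sign[OF \<sigma>, of b] Z_sign[OF \<tau>, of b'] G.one_LO_translate_iff[OF LO[of "(b', \<tau>)"] f Z] \<tau>
      unfolding eq by simp
    have "permutation_order \<sigma> = LO_translate G f (permutation_order \<tau>)"
    proof (cases b)
      case True
      then show ?thesis using eq b by (simp add: ord_def)
    next
      case False
      then show ?thesis
        using eq b G.LO_translate_converse[OF permLO[OF \<tau>]] by (simp add: ord_def)
    qed
    then show "b = b' \<and> \<sigma> = \<tau>"
      using permutation_orders_not_conjugate[OF \<Sigma>[OF \<sigma>] \<Sigma>[OF \<tau>] f] b by simp
  qed
  let ?O = "(\<lambda>p. orbit G (LO_translate G) (ord p)) ` (UNIV \<times> \<Sigma>)"
  have "?O \<subseteq> orbits G (left_orderings G) (LO_translate G)"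
    using LO unfolding orbits_def by blast
  moreover have "finite ?O" using card by simp
  moreover have "card ?O = 2 * fact (m - 1)"
    unfolding card_image[OF inj] by (simp add: card card_cartesian_product)
  moreover have "\<forall>C\<in>?O. C \<subseteq> isolated_orderings G"
    using G.orbit_finitely_determined[OF fd] by blast
  ultimately show ?thesis by blast
qed

end

theorem mainTheorem2:
  fixes m :: nat and a :: "nat \<Rightarrow> nat"
  assumes "m > 1" and "\<forall>i\<in>{1..m}. a i > 1"
  shows "let G = equal_powers_group m a in
    \<exists>\<O> \<subseteq> orbits G (left_orderings G) (LO_translate G).
      finite \<O> \<and> card \<O> \<ge> 2 * fact (m - 1) \<and> (\<forall>C\<in>\<O>. C \<subseteq> isolated_orderings G)"
  using orbits_of_permutation_orders[of m a] assms unfolding Let_def by (metis order_refl)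

end
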